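(* Let $n\ge 3$. Let $\theta: G\to S_{2n}$ be the homomorphism which sends a homotopy class in $G$ to the permutation of the $2n$ vertices of the hyperoctahedron in $\mathbb{R}^n$ induced by the end-point of the class. Then $$\pi_1(SO(n))\cong \ker\theta=\{Id, R_1^{4}\}\cong \mathbb{Z}/2\mathbb{Z}.$$
   Context: The hyperoctahedron in $\mathbb{R}^n$ is the polytope with the $2n$ vertices $\pm e_1,\dots,\pm e_n$ ($e_i$ the standard basis vectors). Its rotational symmetry group (rotational hyperoctahedral group) $G'\subset SO(n)$ consists of the elements of $SO(n)$ that permute these vertices. $G$ is the group of homotopy classes (with fixed end-points) of continuous paths $R:[0,1]\to SO(n)$ with $R(0)=Id$ and $R(1)\in G'$. The product of paths is $(RS)(t)=S(2t)$ for $t<1/2$ and $(RS)(t)=R(2t-1)S(1)$ for $t\ge 1/2$; the inverse of the class of $R$ is the class of $t\mapsto R(t)^{-1}$; $Id$ is the class of the constant path. For $i\neq j$, $R_{ij}$ is (the class of) the path of rotations from angle $0$ to angle $\pi/2$ in the coordinate plane $ij$, whose end-point sends $e_i\mapsto e_j$, $e_j\mapsto -e_i$ and fixes the other basis vectors. Put $R_i:=R_{i\,i+1}$ for $i=1,\dots,n-1$. The group $S_{2n}$ is the symmetric group on the $2n$ vertices. *)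

theory Defs
  imports "HOL-Analysis.Analysis" "HOL-Algebra.Elementary_Groups" "HOL-Algebra.Bij"
begin

text \<open>
  The dimension is \<open>n = CARD('n)\<close>. A function \<open>idx\<close> with \<open>bij_betw idx {1..CARD('n)} UNIV\<close> numbers
  the coordinates, so that \<open>e\<^sub>k = axis (idx k) 1\<close>; only
  \<open>R\<^sub>i = R\<^sub>i\<^sub>,\<^sub>i\<^sub>+\<^sub>1\<close> depends on the numbering.
\<close>

subsection \<open>Homotopy classes of paths and the fundamental group\<close>

text \<open>A path is a function on all of \<open>real\<close>, of which only the restriction to \<open>{0..1}\<close> matters:
  functions that agree there are \<open>homotopic_paths\<close>, hence lie in the same class.\<close>

definition path_class :: "'a::topological_space set \<Rightarrow> (real \<Rightarrow> 'a) \<Rightarrow> (real \<Rightarrow> 'a) set" where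
  "path_class T p = {q. homotopic_paths T p q}"

text \<open>Here and in \<open>hyper_G\<close> below, the union in the product is over representatives of the two
  classes; all of them give the same class.\<close>

definition fundamental_group :: "'a::topological_space set \<Rightarrow> 'a \<Rightarrow> (real \<Rightarrow> 'a) set monoid" where
  "fundamental_group T x0 =
     \<lparr>carrier = path_class T ` {p. path p \<and> path_image p \<subseteq> T \<and> pathstart p = x0 \<and> pathfinish p = x0},
      monoid.mult = (\<lambda>a b. \<Union>p\<in>a. \<Union>q\<in>b. path_class T (p +++ q)),
      one = path_class T (\<lambda>t. x0)\<rparr>"

subsection \<open>The rotational hyperoctahedral group\<close>

definition SO :: "(real^'n^'n) set" where
  "SO = {A. rotation_matrix A}"

definition hyper_vertices :: "(real^'n) set" where
  "hyper_vertices = (\<Union>i. {axis i 1, - axis i 1})"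

definition rot_hyper_group :: "(real^'n^'n) set" where
  "rot_hyper_group = {A \<in> SO. bij_betw (\<lambda>v. A *v v) hyper_vertices hyper_vertices}"

subsection \<open>The group of homotopy classes of paths ending in it\<close>

definition rot_path_mult ::
    "(real \<Rightarrow> real^'n^'n) \<Rightarrow> (real \<Rightarrow> real^'n^'n) \<Rightarrow> real \<Rightarrow> real^'n^'n" where
  "rot_path_mult R S = (\<lambda>t. if t < 1/2 then S (2 * t) else R (2 * t - 1) ** S 1)"

definition hyper_G :: "(real \<Rightarrow> real^'n^'n) set monoid" where
  "hyper_G =
     \<lparr>carrier = path_class SO `
        {R. path R \<and> path_image R \<subseteq> SO \<and> R 0 = mat 1 \<and> R 1 \<in> rot_hyper_group},
      monoid.mult = (\<lambda>a b. \<Union>R\<in>a. \<Union>S\<in>b. path_class SO (rot_path_mult R S)),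
      one = path_class SO (\<lambda>t. mat 1)\<rparr>"

text \<open>The matrix is written by rows, so \<open>A $ k $ l\<close> is the \<open>k\<close>-th coordinate of the image of the
  \<open>l\<close>-th basis vector: \<open>e\<^sub>i\<close> goes to \<open>cos a e\<^sub>i + sin a e\<^sub>j\<close> and \<open>e\<^sub>j\<close> to \<open>- sin a e\<^sub>i + cos a e\<^sub>j\<close>.\<close>

definition plane_rotation :: "'n \<Rightarrow> 'n \<Rightarrow> real \<Rightarrow> real^'n^'n" where
  "plane_rotation i j a = (\<chi> k l.
     if k = i \<and> l = i then cos a
     else if k = j \<and> l = i then sin a
     else if k = i \<and> l = j then - sin a
     else if k = j \<and> l = j then cos a
     else if k = l then 1 else 0)"

definition R_plane :: "'n \<Rightarrow> 'n \<Rightarrow> (real \<Rightarrow> real^'n^'n) set" where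
  "R_plane i j = path_class SO (\<lambda>t. plane_rotation i j (t * (pi / 2)))"

definition R_gen :: "(nat \<Rightarrow> 'n) \<Rightarrow> nat \<Rightarrow> (real \<Rightarrow> real^'n^'n) set" where
  "R_gen idx i = R_plane (idx i) (idx (i + 1))"

subsection \<open>The action on the vertices\<close>

definition class_end :: "(real \<Rightarrow> 'a::topological_space) set \<Rightarrow> 'a" where
  "class_end c = the_elem (pathfinish ` c)"

definition theta :: "(real \<Rightarrow> real^'n^'n) set \<Rightarrow> (real^'n \<Rightarrow> real^'n)" where
  "theta c = restrict (\<lambda>v. class_end c *v v) hyper_vertices"

end

theory Submission
  imports Defs
begin

text \<open>
  Pointwise multiplication of matrices turns out to describe every product of classes at once.
  Delaying one factor and hurrying the other shows that both \<open>rot_path_mult\<close> and the concatenation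
  of loops are homotopic to a pointwise product (\<open>rot_path_mult_homotopic_pointwise\<close>,
  \<open>join_homotopic_pointwise\<close>). So the group laws and the homomorphism property of \<open>theta\<close> are
  those of matrices, the kernel consists of the classes of loops at the identity, and the identity
  map is an isomorphism from the fundamental group to the kernel. It remains to see that there are
  exactly two classes of loops, that of the constant loop and that of a full turn in one coordinate
  plane.

  \<^emph>\<open>At most two.\<close> The evaluation of rotations at a basis vector \<open>e\<^sub>i\<close> is a fibration over a sphere. A
  loop is sent to a loop in that sphere, which contracts as soon as the sphere has dimension at least
  two; the contraction lifts (\<open>homotopy_lift_SO_on\<close>), and the loop is deformed into the stabiliser of
  \<open>e\<^sub>i\<close>. Removing one coordinate after another leaves a loop in the rotations of a single plane
  (\<open>loop_reduce_to_plane\<close>), that is, a number of full turns (\<open>loop_in_plane\<close>). With a third coordinate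
  available the plane can be flipped over by a path of rotations, which deforms any number of turns
  into the same number of turns backwards; so an even number of turns is contractible
  (\<open>even_turns_null_homotopic\<close>).

  \<^emph>\<open>At least two.\<close> In the Clifford algebra, conjugation by a unit vector is minus the reflection in it. The
  even invertible elements that conjugate vectors to vectors, normalised, form a compact set, the
  spin group, whose action on vectors is two-to-one with fibres \<open>{z, -z}\<close> and hence a covering
  (\<open>covering_space_antipodal\<close>); its image contains all of \<open>SO\<close> because every rotation is a product of
  an even number of reflections (\<open>SO_subset_spin_image\<close>). A rotation by the angle \<open>2x\<close> is the product of two
  reflections whose axes form the angle \<open>x\<close>. So the full turn lifts to a path from \<open>1\<close> to \<open>-1\<close>, which is
  not closed, and the full turn is not contractible (\<open>full_turn_not_null_homotopic\<close>).
\<close>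

section \<open>Matrices and the special orthogonal group\<close>

lemma continuous_on_matrix_mult [continuous_intros]:
  fixes f :: "'a::topological_space \<Rightarrow> real^'m^'k" and g :: "'a \<Rightarrow> real^'l^'m"
  assumes "continuous_on S f" "continuous_on S g"
  shows "continuous_on S (\<lambda>x. f x ** g x)"
  unfolding matrix_matrix_mult_def
  by (intro continuous_intros assms)

lemma continuous_on_matrix_vector_mult [continuous_intros]:
  fixes f :: "'a::topological_space \<Rightarrow> real^'m^'k" and g :: "'a \<Rightarrow> real^'m"
  assumes "continuous_on S f" "continuous_on S g"
  shows "continuous_on S (\<lambda>x. f x *v g x)"
  unfolding matrix_vector_mult_def
  by (intro continuous_intros assms)

lemma continuous_on_transpose [continuous_intros]:
  fixes f :: "'a::topological_space \<Rightarrow> real^'m^'k"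
  assumes "continuous_on S f"
  shows "continuous_on S (\<lambda>x. transpose (f x))"
  unfolding transpose_def
  by (intro continuous_intros assms)

lemma matrix_eq_on_axes:
  fixes A B :: "real^'m^'k"
  assumes "\<And>i. A *v axis i 1 = B *v axis i 1"
  shows "A = B"
  using assms by (simp add: matrix_vector_mul_component column_def vec_eq_iff matrix_vector_mult_basis)

lemma orthogonal_matrix_inner:
  fixes A :: "real^'n^'n"
  assumes "orthogonal_matrix A"
  shows "(A *v x) \<bullet> (A *v y) = x \<bullet> y"
  by (metis assms matrix_vector_mul_assoc orthogonal_matrix_def
      dot_lmul_matrix transpose_matrix_vector matrix_vector_mul_lid transpose_transpose)

lemma orthogonal_matrix_norm:
  fixes A :: "real^'n^'n"
  assumes "orthogonal_matrix A"
  shows "norm (A *v x) = norm x"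
  using orthogonal_matrix_inner[OF assms, of x x] by (simp add: norm_eq_sqrt_inner)

lemma mat_1_in_SO: "mat 1 \<in> SO"
  by (simp add: SO_def rotation_matrix_def orthogonal_matrix_id)

lemma SO_mult: "A \<in> SO \<Longrightarrow> B \<in> SO \<Longrightarrow> A ** B \<in> SO"
  by (simp add: SO_def rotation_matrix_def orthogonal_matrix_mul det_mul)

lemma SO_transpose: "A \<in> SO \<Longrightarrow> transpose A \<in> SO"
  by (simp add: SO_def rotation_matrix_def)

lemma SO_orthogonal: "A \<in> SO \<Longrightarrow> orthogonal_matrix A"
  by (simp add: SO_def rotation_matrix_def)

lemma SO_inverse: "A \<in> SO \<Longrightarrow> transpose A ** A = mat 1" "A \<in> SO \<Longrightarrow> A ** transpose A = mat 1"
  by (auto dest: SO_orthogonal simp: orthogonal_matrix_def)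

section \<open>Reflections and minimal rotations\<close>

text \<open>The reflection in the hyperplane orthogonal to \<open>a\<close>. Division by zero makes \<open>refl_mat 0\<close> the identity
  matrix.\<close>
definition refl_mat :: "real^'n \<Rightarrow> real^'n^'n" where
  "refl_mat a = (\<chi> i j. (if i = j then 1 else 0) - 2 * a $ i * a $ j / (a \<bullet> a))"

lemma refl_mat_apply: "refl_mat a *v x = x - (2 * (a \<bullet> x) / (a \<bullet> a)) *\<^sub>R a"
proof -
  have "(refl_mat a *v x) $ i = x $ i - (2 * (a \<bullet> x) / (a \<bullet> a)) * a $ i" for i
  proof -
    have "(refl_mat a *v x) $ i = (\<Sum>j\<in>UNIV. (if i = j then x $ j else 0) - 2 * a $ i / (a \<bullet> a) * (a $ j * x $ j))"
      unfolding refl_mat_def matrix_vector_mult_def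
      by (simp add: left_diff_distrib if_distrib[of "\<lambda>u. u * _"] mult.assoc cong: if_cong)
    also have "\<dots> = x $ i - 2 * a $ i / (a \<bullet> a) * (\<Sum>j\<in>UNIV. a $ j * x $ j)"
      by (simp only: sum_subtractf sum_distrib_left[symmetric]) simp
    also have "(\<Sum>j\<in>UNIV. a $ j * x $ j) = a \<bullet> x" by (simp add: inner_vec_def)
    finally show ?thesis by simp
  qed
  thus ?thesis by (simp add: vec_eq_iff)
qed

lemma transpose_refl_mat [simp]: "transpose (refl_mat a) = refl_mat a"
  by (auto simp: refl_mat_def transpose_def vec_eq_iff)

lemma refl_mat_involution [simp]: "refl_mat a ** refl_mat a = mat 1"
proof (rule matrix_eq_on_axes)
  fix i :: 'a
  show "(refl_mat a ** refl_mat a) *v axis i 1 = mat 1 *v axis i 1"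
    by (cases "a = 0")
      (simp_all add: refl_mat_apply inner_diff_right flip: matrix_vector_mul_assoc)
qed

lemma orthogonal_refl_mat: "orthogonal_matrix (refl_mat a)"
  by (simp add: orthogonal_matrix)

text \<open>Conjugating by an orthogonal matrix that moves a basis vector to \<open>a\<close> reduces the determinant
  to that of a diagonal matrix.\<close>
lemma det_refl_mat:
  fixes a :: "real^'n"
  assumes "a \<noteq> 0"
  shows "det (refl_mat a) = -1"
proof -
  fix k :: 'n
  obtain B :: "real^'n^'n" where B: "orthogonal_matrix B" "B *v axis k 1 = sgn a"
    using orthogonal_matrix_exists_basis[of "sgn a"] assms by (auto simp: norm_sgn)
  let ?D = "refl_mat (axis k 1) :: real^'n^'n"
  have a: "a = norm a *\<^sub>R sgn a" using assms by (simp add: sgn_div_norm)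
  have "refl_mat a ** B = B ** ?D"
  proof (rule matrix_eq_on_axes)
    fix i
    have "a \<bullet> (B *v axis i 1) = norm a * (axis k 1 \<bullet> (axis i 1 :: real^'n))"
      by (subst a) (simp flip: B(2) add: orthogonal_matrix_inner[OF B(1)])
    moreover have "a \<bullet> a = norm a * norm a" by (simp add: dot_square_norm power2_eq_square)
    moreover have "B *v (c *\<^sub>R axis k 1) = (c / norm a) *\<^sub>R a" for c
      using assms by (simp add: scaleR_matrix_vector_assoc B(2) sgn_div_norm
          matrix_vector_mult_scaleR divide_inverse)
    ultimately show "(refl_mat a ** B) *v axis i 1 = (B ** ?D) *v axis i 1"
      using assms by (simp add: refl_mat_apply matrix_vector_mult_diff_distrib
          flip: matrix_vector_mul_assoc)
  qed
  hence "det (refl_mat a) * det B = det B * det ?D" by (metis det_mul)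
  moreover have "det B \<noteq> 0" using det_orthogonal_matrix[OF B(1)] by auto
  moreover have "det ?D = (\<Prod>i\<in>UNIV. ?D $ i $ i)"
    by (rule det_diagonal) (auto simp: refl_mat_def axis_def)
  moreover have "\<dots> = (\<Prod>i\<in>UNIV. if i = k then -1 else 1)"
    by (rule prod.cong) (auto simp: refl_mat_def inner_axis_axis, auto simp: axis_def)
  ultimately have "(det (refl_mat a) + 1) * det B = 0" by (simp add: distrib_right)
  with \<open>det B \<noteq> 0\<close> show ?thesis by simp
qed

text \<open>For unit vectors this is the rotation of the plane of \<open>u\<close> and \<open>v\<close> that carries \<open>u\<close> to \<open>v\<close>. Written as
  a product of reflections it is visibly continuous away from antipodal pairs; being the identity for
  \<open>u = v\<close> as well, it serves as parallel transport over the sphere.\<close>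
definition turn :: "real^'n \<Rightarrow> real^'n \<Rightarrow> real^'n^'n" where
  "turn u v = refl_mat (u + v) ** refl_mat u"

lemma turn_in_SO:
  assumes "u \<noteq> 0" "u + v \<noteq> 0"
  shows "turn u v \<in> SO"
  using assms by (simp add: turn_def SO_def rotation_matrix_def orthogonal_matrix_mul
      orthogonal_refl_mat det_mul det_refl_mat)

lemma turn_moves:
  assumes "norm u = 1" "norm v = 1" "u + v \<noteq> 0"
  shows "turn u v *v u = v"
proof -
  have uv: "u \<bullet> u = 1" "v \<bullet> v = 1" using assms by (simp_all add: norm_eq_1)
  have *: "(u + v) \<bullet> (u + v) = 2 * ((u + v) \<bullet> u)"
    using uv by (simp add: inner_add_left inner_add_right inner_commute)
  have "refl_mat u *v u = -u" using uv by (simp add: refl_mat_apply scaleR_2)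
  moreover have "refl_mat (u + v) *v u = - v"
    using assms(3) unfolding refl_mat_apply by (subst *[symmetric]) simp
  ultimately show ?thesis
    using vec.neg[of "refl_mat (u + v)" u] by (simp add: turn_def flip: matrix_vector_mul_assoc)
qed

lemma turn_same: 
  assumes "u \<noteq> 0"
  shows "turn u u = mat 1"
proof -
  have "refl_mat (2 *\<^sub>R u) = refl_mat u"
    by (simp add: refl_mat_def vec_eq_iff)
  hence "refl_mat (u + u) = refl_mat u" by (simp only: scaleR_2)
  thus ?thesis by (simp add: turn_def)
qed

lemma turn_fixes:
  assumes "u $ j = 0" "v $ j = 0"
  shows "turn u v *v axis j 1 = axis j 1"
proof -
  have "u \<bullet> axis j 1 = 0" "v \<bullet> axis j 1 = 0"
    using assms by (simp_all add: inner_axis)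
  thus ?thesis
    by (simp add: turn_def refl_mat_apply inner_add_left flip: matrix_vector_mul_assoc)
qed

lemma continuous_on_refl_mat:
  assumes "continuous_on S f" "\<And>x. x \<in> S \<Longrightarrow> f x \<noteq> 0"
  shows "continuous_on S (\<lambda>x. refl_mat (f x))"
  unfolding refl_mat_def by (intro continuous_intros assms) (use assms in auto)

lemma continuous_on_turn:
  assumes "continuous_on S f" "continuous_on S g" 
    "\<And>x. x \<in> S \<Longrightarrow> f x \<noteq> 0" "\<And>x. x \<in> S \<Longrightarrow> f x + g x \<noteq> 0"
  shows "continuous_on S (\<lambda>x. turn (f x) (g x))"
  unfolding turn_def by (intro continuous_intros continuous_on_refl_mat assms)

section \<open>Pointwise products of paths of rotations\<close>

lemma homotopic_paths_SO_mult:
  assumes "homotopic_paths SO p p'" "homotopic_paths SO q q'"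
  shows "homotopic_paths SO (\<lambda>t. p t ** q t) (\<lambda>t. p' t ** q' t)"
proof -
  obtain h :: "real \<times> real \<Rightarrow> _" where h: "continuous_on ({0..1} \<times> {0..1}) h" "h \<in> ({0..1} \<times> {0..1}) \<rightarrow> SO"
      "\<forall>x\<in>{0..1}. h (0, x) = p x" "\<forall>x\<in>{0..1}. h (1, x) = p' x"
      "\<forall>t\<in>{0..1}. h (t, 0) = p 0 \<and> h (t, 1) = p 1"
    using assms(1) unfolding homotopic_paths pathstart_def pathfinish_def o_def by blast
  obtain k :: "real \<times> real \<Rightarrow> _" where k: "continuous_on ({0..1} \<times> {0..1}) k" "k \<in> ({0..1} \<times> {0..1}) \<rightarrow> SO"
      "\<forall>x\<in>{0..1}. k (0, x) = q x" "\<forall>x\<in>{0..1}. k (1, x) = q' x"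
      "\<forall>t\<in>{0..1}. k (t, 0) = q 0 \<and> k (t, 1) = q 1"
    using assms(2) unfolding homotopic_paths pathstart_def pathfinish_def o_def by blast
  show ?thesis
    unfolding homotopic_paths
    by (rule exI[of _ "\<lambda>x. h x ** k x"])
      (use h k in \<open>auto intro!: continuous_on_matrix_mult SO_mult simp: Pi_iff pathstart_def pathfinish_def\<close>)
qed

text \<open>Running a path through in the first half of the time and then waiting, or waiting first, changes
  only its parametrisation. Out of such paths a pointwise product becomes a concatenation.\<close>
lemma homotopic_paths_clamp_late:
  assumes "path p" "path_image p \<subseteq> T"
  shows "homotopic_paths T p (\<lambda>t. p (min 1 (2 * t)))"
  by (rule homotopic_paths_reparametrize[where f = "\<lambda>t. min 1 (2 * t)"])
    (use assms in \<open>auto intro!: continuous_intros\<close>)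

lemma homotopic_paths_clamp_early:
  assumes "path p" "path_image p \<subseteq> T"
  shows "homotopic_paths T p (\<lambda>t. p (max 0 (2 * t - 1)))"
  by (rule homotopic_paths_reparametrize[where f = "\<lambda>t. max 0 (2 * t - 1)"])
    (use assms in \<open>auto intro!: continuous_intros\<close>)

definition rot_path :: "(real \<Rightarrow> real^'n^'n) \<Rightarrow> bool" where
  "rot_path R \<longleftrightarrow> path R \<and> path_image R \<subseteq> SO \<and> R 0 = mat 1"

lemma rot_path_pointwise:
  assumes "rot_path R" "rot_path S"
  shows "rot_path (\<lambda>t. R t ** S t)"
  using assms unfolding rot_path_def path_def path_image_def
  by (auto intro!: continuous_on_matrix_mult SO_mult)

lemma rot_path_homotopic: "rot_path R \<Longrightarrow> homotopic_paths SO R S \<Longrightarrow> rot_path S"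
  unfolding rot_path_def
  by (metis homotopic_paths_imp_path homotopic_paths_imp_pathstart homotopic_paths_imp_subset pathstart_def)

lemma homotopic_paths_cong:
  assumes "path p" "path_image p \<subseteq> T" "\<And>t. t \<in> {0..1} \<Longrightarrow> q t = p t"
  shows "homotopic_paths T p q"
  using homotopic_paths_eq assms by metis

lemma rot_path_mult_homotopic_pointwise:
  assumes "rot_path R" "rot_path S"
  shows "homotopic_paths SO (\<lambda>t. R t ** S t) (rot_path_mult R S)"
proof -
  have "homotopic_paths SO (\<lambda>t. R t ** S t) (\<lambda>t. R (max 0 (2 * t - 1)) ** S (min 1 (2 * t)))"
    using assms by (intro homotopic_paths_SO_mult homotopic_paths_clamp_early
        homotopic_paths_clamp_late) (auto simp: rot_path_def)
  also have "(\<lambda>t. R (max 0 (2 * t - 1)) ** S (min 1 (2 * t))) = rot_path_mult R S"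
    using assms by (auto simp: rot_path_mult_def rot_path_def fun_eq_iff max_def min_def)
  finally show ?thesis .
qed

lemma join_homotopic_pointwise:
  assumes "rot_path p" "rot_path q" "p 1 = mat 1"
  shows "homotopic_paths SO (\<lambda>t. p t ** q t) (p +++ q)"
proof -
  have "homotopic_paths SO (\<lambda>t. p t ** q t) (\<lambda>t. p (min 1 (2 * t)) ** q (max 0 (2 * t - 1)))"
    using assms by (intro homotopic_paths_SO_mult homotopic_paths_clamp_early
        homotopic_paths_clamp_late) (auto simp: rot_path_def)
  also have "(\<lambda>t. p (min 1 (2 * t)) ** q (max 0 (2 * t - 1))) = (p +++ q)"
  proof (rule ext)
    fix t :: real
    consider "t < 1/2" | "2 * t = 1" | "t > 1/2" by linarith
    thus "p (min 1 (2 * t)) ** q (max 0 (2 * t - 1)) = (p +++ q) t"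
      by cases (use assms in \<open>simp_all add: joinpaths_def rot_path_def\<close>)
  qed
  finally show ?thesis .
qed

section \<open>Shrinking a loop into a coordinate plane\<close>

text \<open>The dimension is given by a type, so the induction on the dimension runs over sets \<open>F\<close> of
  coordinates instead: \<open>SO_on F\<close> is a copy of the rotation group in dimension \<open>card F\<close>, and
  \<open>sphere_on F\<close> is the sphere on which it acts.\<close>
definition SO_on :: "'n set \<Rightarrow> (real^'n^'n) set" where
  "SO_on F = {A \<in> SO. \<forall>j. j \<notin> F \<longrightarrow> A *v axis j 1 = axis j 1}"

definition sphere_on :: "'n set \<Rightarrow> (real^'n) set" where
  "sphere_on F = {v. norm v = 1 \<and> (\<forall>j. j \<notin> F \<longrightarrow> v $ j = 0)}"

lemma SO_on_mult: "A \<in> SO_on F \<Longrightarrow> B \<in> SO_on F \<Longrightarrow> A ** B \<in> SO_on F"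
  by (simp add: SO_on_def SO_mult flip: matrix_vector_mul_assoc)

lemma turn_in_SO_on:
  assumes "u \<in> sphere_on F" "v \<in> sphere_on F" "u + v \<noteq> 0"
  shows "turn u v \<in> SO_on F"
proof -
  have "u \<noteq> 0" using assms(1) by (auto simp: sphere_on_def)
  thus ?thesis using assms by (auto simp: SO_on_def sphere_on_def turn_fixes intro!: turn_in_SO)
qed

lemma SO_on_column_in_sphere:
  assumes "A \<in> SO_on F" "i \<in> F"
  shows "A *v axis i 1 \<in> sphere_on F"
proof -
  have A: "orthogonal_matrix A" using assms by (auto simp: SO_on_def SO_orthogonal)
  have "(A *v axis i 1) $ j = 0" if "j \<notin> F" for j
  proof -
    have "(A *v axis i 1) $ j = (A *v axis i 1) \<bullet> axis j 1" by (simp add: inner_axis)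
    also have "\<dots> = (A *v axis i 1) \<bullet> (A *v axis j 1)" using assms that by (simp add: SO_on_def)
    also have "\<dots> = 0" using assms(2) that by (auto simp: orthogonal_matrix_inner[OF A] inner_axis_axis)
    finally show ?thesis .
  qed
  thus ?thesis by (simp add: sphere_on_def orthogonal_matrix_norm[OF A])
qed

lemma SO_on_remove:
  assumes "A \<in> SO_on F" "A *v axis i 1 = axis i 1"
  shows "A \<in> SO_on (F - {i})"
  using assms by (auto simp: SO_on_def)

text \<open>The sphere is the relative frontier of the intersection of the unit ball with a coordinate subspace,
  whose dimension is \<open>card F\<close>.\<close>
lemma simply_connected_sphere_on:
  assumes "card F \<ge> 3"
  shows "simply_connected (sphere_on F :: (real^'n) set)"
proof -
  let ?B = "(\<lambda>i. axis i (1::real)) ` F :: (real^'n) set"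
  let ?U = "{v :: real^'n. \<forall>j. j \<notin> F \<longrightarrow> v $ j = 0}"
  have U: "subspace ?U" by (auto simp: subspace_def)
  have aff: "affine ?U" using U by (rule subspace_imp_affine)
  have ind: "independent ?B"
    by (rule independent_mono[OF independent_Basis]) (simp add: Basis_vec_def image_subset_iff, blast)
  have B: "?B \<subseteq> ?U" by (auto simp: axis_def)
  have "card ?B = card F" by (rule card_image) (auto simp: inj_on_def axis_eq_axis)
  have "(0::real^'n) \<in> interior (cball 0 1)" by simp
  moreover have "(0::real^'n) \<in> ?U" by simp
  ultimately have zero: "(0::real^'n) \<in> interior (cball 0 1) \<inter> ?U" by (rule IntI)
  have int: "interior (cball 0 1) \<inter> ?U \<noteq> {}"
    by (rule notI) (rule equals0D[THEN notE, OF _ zero])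
  have "int (card F) \<le> int (dim ?U)"
    using independent_card_le_dim[OF B ind] \<open>card ?B = card F\<close> by simp
  also have "int (dim ?U) = aff_dim ?U" using U by (simp add: aff_dim_subspace)
  also have "\<dots> = aff_dim (cball 0 1 \<inter> ?U)"
  proof -
    have "affine hull (?U \<inter> cball 0 1) = affine hull ?U"
      using int by (intro affine_hull_convex_Int_nonempty_interior subspace_imp_convex[OF U])
        (simp only: Int_commute not_False_eq_True)
    hence "aff_dim (affine hull (cball 0 1 \<inter> ?U)) = aff_dim (affine hull ?U)"
      by (simp only: Int_commute)
    thus ?thesis by (simp only: aff_dim_affine_hull)
  qed
  finally have "3 \<le> aff_dim (cball 0 1 \<inter> ?U)" using assms by linarith
  hence "simply_connected (rel_frontier (cball 0 1 \<inter> ?U))"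
    by (intro simply_connected_sphere_gen convex_Int convex_cball subspace_imp_convex[OF U])
      (simp_all only: bounded_Int bounded_cball simp_thms)
  also have "rel_frontier (cball 0 1 \<inter> ?U) = frontier (cball 0 1) \<inter> ?U"
    by (rule convex_affine_rel_frontier_Int[OF convex_cball aff int])
  also have "\<dots> = sphere_on F" by (auto simp: sphere_on_def)
  finally show ?thesis .
qed

text \<open>Parallel transport along the polygon with vertices \<open>h (0, t), h (d, t), h (2 * d, t), \<dots>\<close>, stopped at
  time \<open>s\<close>. Capping the times at \<open>s\<close> makes later factors trivial, so that one formula holds for
  all \<open>s\<close> and no pieces have to be glued.\<close>
fun lift_steps :: "real \<Rightarrow> (real \<times> real \<Rightarrow> real^'n) \<Rightarrow> (real \<Rightarrow> real^'n^'n) \<Rightarrow> nat \<Rightarrow> real \<times> real \<Rightarrow> real^'n^'n" where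
  "lift_steps d h g 0 (s, t) = g t"
| "lift_steps d h g (Suc k) (s, t) =
     turn (h (min s (real k * d), t)) (h (min s (real (Suc k) * d), t)) ** lift_steps d h g k (s, t)"

text \<open>Homotopy lifting for the evaluation at \<open>e\<^sub>i\<close>. By uniform continuity a fine enough subdivision of
  the time never meets antipodal points, and transport along it is then continuous. Where \<open>h\<close> does not
  move, transport is trivial, so the lifted homotopy fixes the end points.\<close>
lemma homotopy_lift_SO_on:
  fixes g :: "real \<Rightarrow> real^'n^'n" and h :: "real \<times> real \<Rightarrow> real^'n"
  assumes h: "continuous_on ({0..1} \<times> {0..1}) h" "h \<in> {0..1} \<times> {0..1} \<rightarrow> sphere_on F"
    and g: "path g" "path_image g \<subseteq> SO_on F"
    and start: "\<And>t. t \<in> {0..1} \<Longrightarrow> h (0, t) = g t *v axis i 1"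
    and ends: "\<And>s t. s \<in> {0..1} \<Longrightarrow> t \<in> {0,1} \<Longrightarrow> h (s, t) = h (0, t)"
  obtains g' where "homotopic_paths (SO_on F) g g'" "\<And>t. t \<in> {0..1} \<Longrightarrow> g' t *v axis i 1 = h (1, t)"
proof -
  let ?I = "{0..1::real} \<times> {0..1::real}"
  have "uniformly_continuous_on ?I h"
    using h(1) by (intro compact_uniformly_continuous compact_Times) auto
  then obtain e where e: "e > 0" "\<And>x y. x \<in> ?I \<Longrightarrow> y \<in> ?I \<Longrightarrow> dist x y < e \<Longrightarrow> dist (h x) (h y) < 1"
    by (rule uniformly_continuous_onE[OF _ zero_less_one]) (metis dist_commute)
  obtain n :: nat where n: "1 / real (Suc n) < e" using nat_approx_posE[OF e(1)] by blast
  define N where "N = Suc n"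
  have N: "N > 0" "1 / real N < e" using n by (simp_all only: N_def zero_less_Suc)
  define d where "d = 1 / real N"
  have d: "0 < d" "d < e" "N * d = 1" using N by (auto simp: d_def)
  let ?L = "lift_steps d h g"
  have h_unit: "norm (h x) = 1" if "x \<in> ?I" for x using h(2) that by (auto simp: sphere_on_def Pi_iff)
  have mid: "(min s (real k * d), t) \<in> ?I" if "(s, t) \<in> ?I" for s t and k :: nat
    using that d(1) by (simp add: min_le_iff_disj)
  have non_antipodal: "h (min s (real k * d), t) + h (min s (real (Suc k) * d), t) \<noteq> 0" if st: "(s, t) \<in> ?I" for s t k
  proof
    assume "h (min s (real k * d), t) + h (min s (real (Suc k) * d), t) = 0"
    hence eq: "h (min s (real k * d), t) = - h (min s (real (Suc k) * d), t)" by (simp add: eq_neg_iff_add_eq_0)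
    let ?v = "h (min s (real (Suc k) * d), t)"
    have "dist (min s (real k * d)) (min s (real (Suc k) * d)) \<le> d"
    proof -
      have "real (Suc k) * d = real k * d + d" by (simp add: distrib_right)
      thus ?thesis using d(1) unfolding dist_real_def min_def by auto
    qed
    hence "dist (min s (real k * d), t) (min s (real (Suc k) * d), t) < e"
      using d(2) by (simp add: dist_Pair_Pair)
    from e(2)[OF mid[OF st] mid[OF st] this]
    have "norm (- ?v - ?v) < 1" by (simp only: eq dist_norm)
    moreover have "- ?v - ?v = (-2) *\<^sub>R ?v" by (simp add: vec_eq_iff)
    ultimately have "norm ((-2) *\<^sub>R ?v) < 1" by (simp only:)
    thus False using h_unit[OF mid[OF st]] by (simp only: norm_scaleR)
  qed
  have L: "?L k (s, t) *v axis i 1 = h (min s (real k * d), t) \<and> ?L k (s, t) \<in> SO_on F" if st: "(s, t) \<in> ?I" for s t k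
  proof (induction k)
    case 0
    thus ?case using st start g(2) by (auto simp: path_image_def)
  next
    case (Suc k)
    moreover have "h (min s (real k * d), t) \<in> sphere_on F" "h (min s (real (Suc k) * d), t) \<in> sphere_on F"
      using h(2) mid[OF st] by blast+
    ultimately show ?case
      using non_antipodal[OF st, of k] h_unit[OF mid[OF st]]
      by (auto simp: turn_moves turn_in_SO_on SO_on_mult simp del: of_nat_Suc simp flip: matrix_vector_mul_assoc)
  qed
  have cont: "continuous_on ?I (?L k)" for k
  proof (induction k)
    case 0
    have "continuous_on ?I (\<lambda>x. g (snd x))"
      by (rule continuous_on_compose2[OF g(1)[unfolded path_def]]) (auto intro: continuous_intros)
    thus ?case by (rule continuous_on_eq) auto
  next
    case (Suc k)
    have hc: "continuous_on ?I (\<lambda>x. h (min (fst x) (real k * d), snd x))" for k :: nat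
    proof (rule continuous_on_compose2[OF h(1)])
      show "continuous_on ?I (\<lambda>x. (min (fst x) (real k * d), snd x))" by (intro continuous_intros)
    qed (use d(1) in \<open>auto simp: min_le_iff_disj\<close>)
    have "continuous_on ?I (\<lambda>x. turn (h (min (fst x) (real k * d), snd x)) (h (min (fst x) (real (Suc k) * d), snd x)) ** ?L k x)"
    proof (intro continuous_intros continuous_on_turn hc Suc)
      fix x assume "x \<in> ?I"
      hence x: "(fst x, snd x) \<in> ?I" by simp
      show "h (min (fst x) (real k * d), snd x) \<noteq> 0" using h_unit[OF mid[OF x]] by (metis norm_zero zero_neq_one)
      show "h (min (fst x) (real k * d), snd x) + h (min (fst x) (real (Suc k) * d), snd x) \<noteq> 0"
        by (rule non_antipodal[OF x])
    qed
    thus ?case by (rule continuous_on_eq) auto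
  qed
  have at0: "?L k (0, t) = g t" if "t \<in> {0..1}" for k t
  proof (induction k)
    case (Suc k)
    have "h (0, t) \<noteq> 0" using h_unit[of "(0,t)"] that by auto
    thus ?case using Suc d(1) by (simp add: turn_same min_def)
  qed simp
  have atend: "?L k (s, t) = g t" if "t \<in> {0,1}" "s \<in> {0..1}" for k s t
  proof (induction k)
    case (Suc k)
    have "h (0, t) \<noteq> 0" using h_unit[of "(0,t)"] that by auto
    moreover have "h (min s (real k * d), t) = h (0, t)" for k :: nat
      using that d by (intro ends) auto
    ultimately show ?case using Suc by (simp add: turn_same del: of_nat_Suc)
  qed simp
  show ?thesis
  proof
    show "homotopic_paths (SO_on F) g (\<lambda>t. ?L N (1, t))"
      unfolding homotopic_paths
      by (rule exI[of _ "?L N"]) (use cont L at0 atend in \<open>auto simp: pathstart_def pathfinish_def\<close>)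
    show "?L N (1, t) *v axis i 1 = h (1, t)" if "t \<in> {0..1}" for t
      using L[of 1 t N] that d(3) by auto
  qed
qed

text \<open>The orbit of \<open>e\<^sub>i\<close> under the loop contracts to \<open>e\<^sub>i\<close>, and at the end of the lifted contraction all
  matrices fix \<open>e\<^sub>i\<close>.\<close>
lemma loop_reduce_coordinate:
  fixes g :: "real \<Rightarrow> real^'n^'n"
  assumes "card F \<ge> 3" "i \<in> F"
    and g: "path g" "path_image g \<subseteq> SO_on F" "g 0 = mat 1" "g 1 = mat 1"
  obtains g' where "homotopic_paths (SO_on F) g g'" "path_image g' \<subseteq> SO_on (F - {i})"
proof -
  let ?p = "\<lambda>t. g t *v axis i 1"
  have "path ?p" using g(1) unfolding path_def by (intro continuous_intros)
  moreover have im: "path_image ?p \<subseteq> sphere_on F"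
    using g(2) assms(2) by (auto simp: path_image_def intro!: SO_on_column_in_sphere)
  moreover have "pathfinish ?p = pathstart ?p" using g by (simp add: pathstart_def pathfinish_def)
  ultimately have "homotopic_paths (sphere_on F) ?p (linepath (pathstart ?p) (pathstart ?p))"
    using simply_connected_sphere_on[OF assms(1)] unfolding simply_connected_eq_contractible_path by blast
  hence "homotopic_paths (sphere_on F) ?p (\<lambda>t. axis i 1)"
    using g by (simp add: pathstart_def linepath_def algebra_simps flip: scaleR_add_left)
  then obtain h :: "real \<times> real \<Rightarrow> _" where h: "continuous_on ({0..1} \<times> {0..1}) h" "h \<in> ({0..1} \<times> {0..1}) \<rightarrow> sphere_on F"
      "\<forall>x\<in>{0..1}. h (0, x) = ?p x" "\<forall>x\<in>{0..1}. h (1, x) = axis i 1"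
      "\<forall>t\<in>{0..1}. h (t, 0) = ?p 0 \<and> h (t, 1) = ?p 1"
    unfolding homotopic_paths pathstart_def pathfinish_def o_def by blast
  obtain g' where g': "homotopic_paths (SO_on F) g g'" "\<And>t. t \<in> {0..1} \<Longrightarrow> g' t *v axis i 1 = h (1, t)"
    by (rule homotopy_lift_SO_on[OF h(1,2) g(1,2)]) (use h(3,5) in auto)
  have "g' t \<in> SO_on (F - {i})" if "t \<in> {0..1}" for t
    using g'(2)[OF that] h(4) that homotopic_paths_imp_subset[OF g'(1)]
    by (intro SO_on_remove) (auto simp: path_image_def)
  with g'(1) show ?thesis by (intro that) (auto simp: path_image_def)
qed

lemma loop_reduce_to_plane:
  fixes g :: "real \<Rightarrow> real^'n^'n"
  assumes "a \<noteq> b" and g: "path g" "path_image g \<subseteq> SO" "g 0 = mat 1" "g 1 = mat 1"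
  obtains g' where "homotopic_paths SO g g'" "path_image g' \<subseteq> SO_on {a, b}"
proof -
  have sub: "SO_on F \<subseteq> SO" for F :: "'n set" by (auto simp: SO_on_def)
  have "\<exists>g'. homotopic_paths SO g g' \<and> path_image g' \<subseteq> SO_on {a, b}"
    if "finite D" "D \<inter> {a, b} = {}" "path g" "path_image g \<subseteq> SO_on (D \<union> {a, b})" "g 0 = mat 1" "g 1 = mat 1"
    for D :: "'n set" and g
    using that
  proof (induction D arbitrary: g)
    case empty
    thus ?case using sub[of "{a,b}"] by (auto intro!: exI[of _ g])
  next
    case (insert i D)
    have "card (insert i D \<union> {a, b}) = card (insert i D) + card {a, b}"
      using insert by (intro card_Un_disjoint) auto
    hence "card (insert i D \<union> {a, b}) \<ge> 3" using insert assms(1) by simp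
    then obtain g1 where g1: "homotopic_paths (SO_on (insert i D \<union> {a, b})) g g1"
      "path_image g1 \<subseteq> SO_on (insert i D \<union> {a, b} - {i})"
      using loop_reduce_coordinate[of "insert i D \<union> {a,b}" i g] insert by blast
    have *: "insert i D \<union> {a, b} - {i} = D \<union> {a, b}" using insert by auto
    have "\<exists>g'. homotopic_paths SO g1 g' \<and> path_image g' \<subseteq> SO_on {a, b}"
    proof (rule insert.IH)
      show "path_image g1 \<subseteq> SO_on (D \<union> {a, b})" using g1(2) unfolding * .
      show "path g1" using g1(1) homotopic_paths_imp_path by blast
      show "g1 0 = mat 1" "g1 1 = mat 1"
        using homotopic_paths_imp_pathstart[OF g1(1)] homotopic_paths_imp_pathfinish[OF g1(1)] insert.prems
        by (simp_all add: pathstart_def pathfinish_def)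
    qed (use insert in auto)
    thus ?case using homotopic_paths_subset[OF g1(1) sub] homotopic_paths_trans by blast
  qed
  from this[of "- {a, b}" g] g show ?thesis using that by (auto simp: SO_on_def)
qed

section \<open>Rotations of a coordinate plane\<close>

lemma plane_rotation_mult:
  assumes "a \<noteq> b"
  shows "plane_rotation a b x ** plane_rotation a b y = plane_rotation a b (x + y)"
proof -
  have "(\<Sum>k\<in>UNIV. plane_rotation a b x $ i $ k * plane_rotation a b y $ k $ j) = plane_rotation a b (x + y) $ i $ j" for i j
  proof -
    have "(\<Sum>k\<in>UNIV. plane_rotation a b x $ i $ k * plane_rotation a b y $ k $ j) =
       (\<Sum>k\<in>{a,b}. plane_rotation a b x $ i $ k * plane_rotation a b y $ k $ j) +
       (\<Sum>k\<in>-{a,b}. plane_rotation a b x $ i $ k * plane_rotation a b y $ k $ j)"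
      by (subst sum.union_disjoint[symmetric]) auto
    also have "(\<Sum>k\<in>-{a,b}. plane_rotation a b x $ i $ k * plane_rotation a b y $ k $ j) =
        (\<Sum>k\<in>-{a,b}. if k = i then of_bool (i = j) else 0)"
      by (rule sum.cong) (auto simp: plane_rotation_def)
    finally show ?thesis using assms
      by (auto simp: plane_rotation_def cos_add sin_add algebra_simps)
  qed
  thus ?thesis by (simp add: vec_eq_iff matrix_matrix_mult_def)
qed

lemma plane_rotation_0:
  fixes a b :: "'n::finite"
  shows "plane_rotation a b 0 = mat 1"
proof -
  have "plane_rotation a b 0 $ k $ l = (mat 1 :: real^'n^'n) $ k $ l" for k l
    unfolding plane_rotation_def vec_lambda_beta mat_def
    by (cases "k = a"; cases "l = a"; cases "k = b"; cases "l = b") auto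
  thus ?thesis by (simp add: vec_eq_iff)
qed

lemma plane_rotation_fixes:
  assumes "j \<noteq> a" "j \<noteq> b"
  shows "plane_rotation a b x *v axis j 1 = axis j 1"
  using assms unfolding matrix_vector_mult_basis
  by (auto simp: column_def plane_rotation_def axis_def vec_eq_iff)

lemma plane_rotation_first:
  "a \<noteq> b \<Longrightarrow> plane_rotation a b x *v axis a 1 = cos x *\<^sub>R axis a 1 + sin x *\<^sub>R axis b 1"
  unfolding matrix_vector_mult_basis
  by (auto simp: column_def plane_rotation_def axis_def vec_eq_iff)

lemma plane_rotation_second:
  "a \<noteq> b \<Longrightarrow> plane_rotation a b x *v axis b 1 = - sin x *\<^sub>R axis a 1 + cos x *\<^sub>R axis b 1"
  unfolding matrix_vector_mult_basis
  by (auto simp: column_def plane_rotation_def axis_def vec_eq_iff)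

text \<open>The half angle on the right is the reason why the loop of full turns does not lift to a loop in the
  spin group.\<close>
lemma plane_rotation_conv_reflections:
  fixes a b :: "'n::finite"
  assumes "a \<noteq> b"
  shows "plane_rotation a b (2 * x) = refl_mat (cos x *\<^sub>R axis a 1 + sin x *\<^sub>R axis b 1) ** refl_mat (axis a 1)"
proof (rule matrix_eq_on_axes)
  fix i
  let ?u = "cos x *\<^sub>R axis a 1 + sin x *\<^sub>R axis b 1 :: real^'n"
  have [simp]: "axis a (1::real) \<bullet> axis b 1 = 0" "axis b (1::real) \<bullet> axis a 1 = 0"
    using assms by (auto simp: inner_axis_axis)
  have u: "?u \<bullet> ?u = 1"
    using assms sin_cos_squared_add3[of x] by (simp add: inner_add_left inner_add_right inner_axis_axis)
  have ua: "?u \<bullet> axis a 1 = cos x" and ub: "?u \<bullet> axis b 1 = sin x"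
    using assms by (simp_all add: inner_add_left inner_axis_axis)
  have ui: "?u \<bullet> axis i 1 = 0" if "i \<noteq> a" "i \<noteq> b"
    using that by (simp add: inner_add_left inner_axis_axis)
  consider "i = a" | "i = b" | "i \<noteq> a" "i \<noteq> b" by blast
  thus "plane_rotation a b (2 * x) *v axis i 1 = (refl_mat ?u ** refl_mat (axis a 1)) *v axis i 1"
  proof cases
    case 1
    have "refl_mat (axis a 1) *v axis i 1 = - axis a 1"
      using 1 by (simp add: refl_mat_apply inner_axis_axis scaleR_2)
    hence "(refl_mat ?u ** refl_mat (axis a 1)) *v axis i 1 = - axis a 1 + (2 * cos x) *\<^sub>R ?u"
      by (simp add: refl_mat_apply u ua flip: matrix_vector_mul_assoc)
    also have "\<dots> = cos (2 * x) *\<^sub>R axis a 1 + sin (2 * x) *\<^sub>R axis b 1"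
      unfolding cos_double_cos sin_double by (simp add: vec_eq_iff power2_eq_square algebra_simps)
    finally show ?thesis using 1 plane_rotation_first[OF assms] by simp
  next
    case 2
    have "refl_mat (axis a 1) *v axis i 1 = axis b 1"
      using 2 by (simp add: refl_mat_apply)
    hence "(refl_mat ?u ** refl_mat (axis a 1)) *v axis i 1 = axis b 1 - (2 * sin x) *\<^sub>R ?u"
      by (simp add: refl_mat_apply u ub flip: matrix_vector_mul_assoc)
    also have "\<dots> = - sin (2 * x) *\<^sub>R axis a 1 + cos (2 * x) *\<^sub>R axis b 1"
      unfolding cos_double_sin sin_double by (simp add: vec_eq_iff power2_eq_square algebra_simps)
    finally show ?thesis using 2 plane_rotation_second[OF assms] by simp
  next
    case 3
    thus ?thesis
      by (simp add: plane_rotation_fixes refl_mat_apply ui inner_axis_axis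
          flip: matrix_vector_mul_assoc)
  qed
qed

lemma plane_rotation_in_SO:
  fixes a b :: "'n::finite"
  assumes "a \<noteq> b"
  shows "plane_rotation a b x \<in> SO"
proof -
  let ?u = "cos (x/2) *\<^sub>R axis a 1 + sin (x/2) *\<^sub>R axis b 1 :: real^'n"
  have "?u \<bullet> ?u = 1"
    using assms sin_cos_squared_add3[of "x/2"] by (simp add: inner_add_left inner_add_right inner_axis_axis)
  hence "?u \<noteq> 0" by auto
  moreover have "plane_rotation a b x = refl_mat ?u ** refl_mat (axis a 1)"
    using plane_rotation_conv_reflections[OF assms, of "x/2"] by simp
  ultimately show ?thesis
    by (simp add: SO_def rotation_matrix_def orthogonal_matrix_mul orthogonal_refl_mat det_mul det_refl_mat)
qed

lemma continuous_on_plane_rotation [continuous_intros]: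
  fixes f :: "'a::t2_space \<Rightarrow> real"
  assumes "continuous_on S f"
  shows "continuous_on S (\<lambda>x. plane_rotation a b (f x))"
proof -
  have "continuous_on S (\<lambda>x. plane_rotation a b (f x) $ k $ l)" for k l
    unfolding plane_rotation_def vec_lambda_beta
    by (cases "k = a"; cases "l = a"; cases "k = b"; cases "l = b"; cases "k = l")
      (auto intro!: continuous_intros assms)
  hence "continuous_on S (\<lambda>x. \<chi> k l. plane_rotation a b (f x) $ k $ l)"
    by (intro continuous_on_vec_lambda)
  thus ?thesis by (simp only: vec_lambda_eta)
qed

text \<open>Angles may be interpolated linearly.\<close>
lemma homotopic_plane_rotations:
  assumes "a \<noteq> b" "continuous_on {0..1} f" "continuous_on {0..1} g" "f 0 = g 0" "f 1 = g 1"
  shows "homotopic_paths SO (\<lambda>t. plane_rotation a b (f t)) (\<lambda>t. plane_rotation a b (g t))"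
proof -
  have "continuous_on ({0..1} \<times> {0..1}) (\<lambda>x. plane_rotation a b ((1 - fst x) * f (snd x) + fst x * g (snd x)))"
    by (intro continuous_intros continuous_on_compose2[OF assms(2), of _ snd] continuous_on_compose2[OF assms(3), of _ snd]) auto
  thus ?thesis
    unfolding homotopic_paths
    by (intro exI[of _ "\<lambda>x. plane_rotation a b ((1 - fst x) * f (snd x) + fst x * g (snd x))"])
      (use assms in \<open>auto simp: plane_rotation_in_SO pathstart_def pathfinish_def algebra_simps\<close>)
qed

text \<open>The remaining basis vector can only be mapped to plus or minus itself, and the determinant excludes
  the sign.\<close>
lemma SO_on_singleton:
  assumes "A \<in> SO_on {b}"
  shows "A = mat 1"
proof -
  let ?v = "A *v axis b 1"
  have v: "norm ?v = 1" "\<And>j. j \<noteq> b \<Longrightarrow> ?v $ j = 0"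
    using SO_on_column_in_sphere[OF assms, of b] by (auto simp: sphere_on_def)
  hence ve: "?v = (?v $ b) *\<^sub>R axis b 1" by (auto simp: vec_eq_iff axis_def)
  hence "norm ?v = \<bar>?v $ b\<bar>" by (metis norm_scaleR norm_axis_1 mult.right_neutral)
  hence "?v $ b = 1 \<or> ?v $ b = -1" using v(1) by linarith
  moreover have "?v $ b \<noteq> -1"
  proof
    assume "?v $ b = -1"
    hence "?v = - axis b 1" using ve by simp
    hence "A = refl_mat (axis b 1)"
      using assms by (intro matrix_eq_on_axes)
        (case_tac "i = b"; simp add: SO_on_def refl_mat_apply inner_axis_axis scaleR_2)
    moreover have "axis b (1::real) \<noteq> 0" by (simp add: axis_eq_0_iff)
    ultimately show False
      using assms by (simp add: det_refl_mat SO_on_def SO_def rotation_matrix_def)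
  qed
  ultimately have "?v = axis b 1" using ve by simp
  thus ?thesis using assms by (intro matrix_eq_on_axes) (case_tac "i = b"; simp add: SO_on_def)
qed

lemma SO_on_pair:
  assumes "a \<noteq> b" "A \<in> SO_on {a, b}" "A $ a $ a = cos x" "A $ b $ a = sin x"
  shows "A = plane_rotation a b x"
proof -
  let ?B = "plane_rotation a b (- x) ** A"
  have A: "A *v axis a 1 = plane_rotation a b x *v axis a 1"
  proof -
    have "A $ k $ a = 0" if "k \<noteq> a" "k \<noteq> b" for k
      using SO_on_column_in_sphere[OF assms(2), of a] that
      by (simp add: sphere_on_def matrix_vector_mult_basis column_def)
    thus ?thesis using assms
      by (auto simp: vec_eq_iff matrix_vector_mult_basis column_def plane_rotation_def)
  qed
  have "?B *v axis a 1 = axis a 1"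
    by (simp only: matrix_vector_mul_assoc[symmetric] A)
      (simp add: matrix_vector_mul_assoc plane_rotation_mult[OF assms(1)] plane_rotation_0)
  moreover have "?B *v axis j 1 = axis j 1" if "j \<notin> {a, b}" for j
    using assms(2) that by (simp add: SO_on_def plane_rotation_fixes flip: matrix_vector_mul_assoc)
  ultimately have "?B *v axis j 1 = axis j 1" if "j \<noteq> b" for j
    using that by (cases "j = a") auto
  moreover have "?B \<in> SO"
    using assms by (auto simp: SO_on_def intro!: SO_mult plane_rotation_in_SO)
  ultimately have "?B \<in> SO_on {b}" by (simp add: SO_on_def)
  hence "?B = mat 1" by (rule SO_on_singleton)
  hence "plane_rotation a b x ** ?B = plane_rotation a b x" by simp
  thus ?thesis
    by (simp add: matrix_mul_assoc plane_rotation_mult[OF assms(1)] plane_rotation_0)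
qed

text \<open>The column of the matrices at \<open>a\<close> traces a loop in the unit circle. A continuous logarithm supplies an
  angle, which grows by a multiple of \<open>2 * pi\<close> and can be straightened.\<close>
lemma loop_in_plane:
  fixes g :: "real \<Rightarrow> real^'n^'n"
  assumes "a \<noteq> b" and g: "path g" "path_image g \<subseteq> SO_on {a, b}" "g 0 = mat 1" "g 1 = mat 1"
  obtains m :: int where "homotopic_paths SO g (\<lambda>t. plane_rotation a b (2 * pi * m * t))"
proof -
  define z where "z t = Complex (g t $ a $ a) (g t $ b $ a)" for t
  have mem: "g t \<in> SO_on {a, b}" if "t \<in> {0..1}" for t
    using g(2) that by (auto simp: path_image_def)
  have "continuous_on {0..1} g" using g(1) by (simp add: path_def)
  hence cz: "continuous_on {0..1} z"
    unfolding z_def Complex_eq by (intro continuous_intros)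
  have nz: "norm (z t) = 1" if "t \<in> {0..1}" for t
  proof -
    have s: "g t *v axis a 1 \<in> sphere_on {a, b}"
      by (rule SO_on_column_in_sphere[OF mem[OF that]]) simp
    hence "1 = (g t *v axis a 1) \<bullet> (g t *v axis a 1)" by (simp add: sphere_on_def norm_eq_1)
    also have "\<dots> = (\<Sum>k\<in>UNIV. (g t $ k $ a)\<^sup>2)"
      by (simp add: inner_vec_def matrix_vector_mult_basis column_def power2_eq_square)
    also have "\<dots> = (\<Sum>k\<in>{a,b}. (g t $ k $ a)\<^sup>2)"
      using s by (intro sum.mono_neutral_right) (auto simp: sphere_on_def matrix_vector_mult_basis column_def)
    finally show ?thesis using assms(1) by (simp add: z_def cmod_def)
  qed
  obtain h0 where h0: "continuous_on {0..1} h0" "\<And>t. t \<in> {0..1} \<Longrightarrow> z t = exp (h0 t)"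
    using continuous_logarithm_on_contractible[OF cz] nz
    by (metis convex_imp_contractible convex_real_interval(5) norm_zero zero_neq_one)
  have z01: "z 0 = 1" "z 1 = 1" using assms(1) g by (simp_all add: z_def mat_def complex_eq_iff)
  \<comment> \<open>Shifting by a period makes the angle start at 0.\<close>
  define h where "h t = h0 t - h0 0" for t
  have h: "continuous_on {0..1} h" "\<And>t. t \<in> {0..1} \<Longrightarrow> z t = exp (h t)" "h 0 = 0"
    using h0 z01 by (auto simp: h_def exp_diff intro!: continuous_intros)
  have rot: "g t = plane_rotation a b (Im (h t))" if "t \<in> {0..1}" for t
  proof (rule SO_on_pair[OF assms(1) mem[OF that]])
    have "Re (h t) = 0" using nz[OF that] h(2)[OF that] by simp
    hence "z t = cis (Im (h t))" using h(2)[OF that] by (simp add: exp_eq_polar)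
    thus "g t $ a $ a = cos (Im (h t))" "g t $ b $ a = sin (Im (h t))"
      by (simp_all add: z_def complex_eq_iff)
  qed
  have "exp (h 1) = 1" using h(2)[of 1] z01 by simp
  then obtain m :: int where m: "Im (h 1) = of_int (2 * m) * pi" by (auto simp: exp_eq_1)
  have "homotopic_paths SO g (\<lambda>t. plane_rotation a b (Im (h t)))"
    using g by (intro homotopic_paths_cong) (auto simp: rot SO_on_def)
  also have "homotopic_paths SO \<dots> (\<lambda>t. plane_rotation a b (2 * pi * m * t))"
    using h m by (intro homotopic_plane_rotations assms continuous_intros) auto
  finally show ?thesis by (rule that)
qed

section \<open>The Clifford algebra\<close>

text \<open>Sets of coordinates form a group of exponent two under this operation. A constant of its own keeps
  the simplifier from splitting it into unions and differences.\<close>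
definition symdiff :: "'a set \<Rightarrow> 'a set \<Rightarrow> 'a set" where
  "symdiff A B = sym_diff A B"

lemma symdiff_commute: "symdiff A B = symdiff B A" by (auto simp: symdiff_def)
lemma symdiff_self [simp]: "symdiff A A = {}" by (auto simp: symdiff_def)
lemma symdiff_empty [simp]: "symdiff A {} = A" "symdiff {} A = A" by (auto simp: symdiff_def)
lemma symdiff_cancel [simp]: "symdiff A (symdiff A B) = B" by (auto simp: symdiff_def)
lemma symdiff_cancel_right [simp]: "symdiff (symdiff B A) A = B" by (auto simp: symdiff_def)
lemma symdiff_cancel_mid [simp]: "symdiff (symdiff A B) A = B" by (auto simp: symdiff_def)

lemma even_card_symdiff:
  assumes "finite A" "finite B"
  shows "even (card (symdiff A B)) \<longleftrightarrow> (even (card A) = even (card B))"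
proof -
  have "card A = card (A - B) + card (A \<inter> B)" "card B = card (B - A) + card (A \<inter> B)"
    using assms card_Un_disjoint[of "A - B" "A \<inter> B"] card_Un_disjoint[of "B - A" "A \<inter> B"]
    by (simp_all add: Un_Diff_Int Int_commute[of A B] Diff_Int_distrib Diff_disjoint Int_Diff disjoint_iff)
      (metis Int_commute Un_Diff_Int)
  moreover have "card (symdiff A B) = card (A - B) + card (B - A)"
    unfolding symdiff_def using assms by (intro card_Un_disjoint) auto
  ultimately show ?thesis by auto
qed

lemma prod_symdiff:
  fixes f :: "'a \<Rightarrow> 'b::comm_ring_1"
  assumes "finite A" "finite B" "\<And>x. f x * f x = 1"
  shows "prod f (symdiff A B) = prod f A * prod f B"
proof -
  have A: "prod f A = prod f (A - B) * prod f (A \<inter> B)"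
    using assms by (subst prod.union_disjoint[symmetric]) (auto intro: prod.cong arg_cong2[where f = prod])
  have B: "prod f B = prod f (B - A) * prod f (A \<inter> B)"
    using assms by (subst prod.union_disjoint[symmetric]) (auto intro: prod.cong arg_cong2[where f = prod])
  have "prod f (A \<inter> B) * prod f (A \<inter> B) = 1"
    by (simp add: assms(3) flip: prod.distrib)
  moreover have "prod f (symdiff A B) = prod f (A - B) * prod f (B - A)"
    unfolding symdiff_def using assms by (intro prod.union_disjoint) auto
  ultimately show ?thesis unfolding A B by (simp add: algebra_simps)
qed

text \<open>The Clifford algebra has a basis of ordered products \<open>e\<^sub>S\<close> of generators, one for each set \<open>S\<close> of
  coordinates. Sorting the product of \<open>e\<^sub>S\<close> and \<open>e\<^sub>T\<close> costs one sign for each pair that is out of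
  order; equal generators cancel, as \<open>e\<^sub>i * e\<^sub>i = 1\<close>. The order of the coordinates is any linear
  one, here that of an injection into the natural numbers. The sign is bimultiplicative with respect to
  symmetric differences, and all algebraic laws below come from this.\<close>
definition swap_sign :: "'n::finite \<Rightarrow> 'n \<Rightarrow> real" where
  "swap_sign s t = (if to_nat t < to_nat s then -1 else 1)"

definition blade_sign :: "'n::finite set \<Rightarrow> 'n set \<Rightarrow> real" where
  "blade_sign S T = (\<Prod>s\<in>S. \<Prod>t\<in>T. swap_sign s t)"

lemma swap_sign_square: "swap_sign s t * swap_sign s t = 1"
  by (simp add: swap_sign_def)

lemma swap_sign_anti: "s \<noteq> t \<Longrightarrow> swap_sign t s = - swap_sign s t"
  using inj_to_nat[THEN injD, of s t] by (auto simp: swap_sign_def)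

lemma blade_sign_square [simp]: "blade_sign S T * blade_sign S T = 1"
  by (simp add: blade_sign_def swap_sign_square flip: prod.distrib)

lemma blade_sign_square_left [simp]: "blade_sign S T * (blade_sign S T * x) = x"
  by (simp flip: mult.assoc)

lemma blade_sign_symdiff_right: "blade_sign S (symdiff T U) = blade_sign S T * blade_sign S U"
  unfolding blade_sign_def by (simp add: prod_symdiff swap_sign_square prod.distrib)

lemma blade_sign_symdiff_left: "blade_sign (symdiff S T) U = blade_sign S U * blade_sign T U"
  unfolding blade_sign_def
  by (intro prod_symdiff) (simp_all add: swap_sign_square flip: prod.distrib)

lemma blade_sign_empty [simp]: "blade_sign {} T = 1" "blade_sign S {} = 1"
  by (simp_all add: blade_sign_def)

lemma blade_sign_singletons [simp]: "blade_sign {i} {j} = swap_sign i j"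
  by (simp add: blade_sign_def)

text \<open>Moving \<open>e\<^sub>i\<close> past the factors of \<open>e\<^sub>S\<close> gives a sign for each of them but \<open>e\<^sub>i\<close> itself, hence an
  odd number of signs.\<close>
lemma blade_sign_swap:
  assumes "i \<in> S" "even (card S)"
  shows "blade_sign S {i} = - blade_sign {i} S"
proof -
  have "blade_sign S {i} * blade_sign {i} S = (\<Prod>s\<in>S. swap_sign s i * swap_sign i s)"
    by (simp add: blade_sign_def prod.distrib)
  also have "\<dots> = (swap_sign i i * swap_sign i i) * (\<Prod>s\<in>S-{i}. swap_sign s i * swap_sign i s)"
    by (rule prod.remove) (use assms in auto)
  also have "(\<Prod>s\<in>S-{i}. swap_sign s i * swap_sign i s) = (\<Prod>s\<in>S-{i}. -1)"
    by (rule prod.cong) (auto simp: swap_sign_anti[of _ i] swap_sign_square)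
  also have "\<dots> = (-1) ^ (card S - 1)" using assms(1) by (simp add: card_Diff_singleton)
  also have "\<dots> = -1"
  proof -
    have "card S \<noteq> 0" using assms(1) by auto
    hence "odd (card S - 1)" using assms(2) by presburger
    thus ?thesis by simp
  qed
  finally have "blade_sign S {i} * blade_sign {i} S = -1" by (simp add: swap_sign_square)
  hence "blade_sign S {i} * blade_sign {i} S * blade_sign {i} S = - blade_sign {i} S" by simp
  thus ?thesis by (simp add: mult.assoc)
qed

text \<open>The product of the Clifford algebra: the group algebra of the sets of coordinates under symmetric
  difference, twisted by the sign. The unit is \<open>blade {}\<close>.\<close>
definition clifford_mult :: "real^('n::finite set) \<Rightarrow> real^('n set) \<Rightarrow> real^('n set)" (infixl "\<star>" 70) where
  "x \<star> y = (\<chi> U. \<Sum>S\<in>UNIV. blade_sign S (symdiff S U) * x $ S * y $ (symdiff S U))"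

abbreviation blade :: "'n::finite set \<Rightarrow> real^('n set)" where
  "blade S \<equiv> axis S 1"

lemma bilinear_clifford_mult: "bilinear (\<star>)"
  unfolding bilinear_def
  by (auto intro!: linearI simp: clifford_mult_def vec_eq_iff sum.distrib[symmetric] sum_distrib_left algebra_simps)

interpretation clifford_mult: bounded_bilinear "(\<star>)"
  using bilinear_clifford_mult by (simp only: bilinear_conv_bounded_bilinear)

text \<open>A bimultiplicative sign is a two-cocycle.\<close>
lemma clifford_mult_assoc: "(x \<star> y) \<star> z = x \<star> (y \<star> z)"
proof -
  have "((x \<star> y) \<star> z) $ V = (x \<star> (y \<star> z)) $ V" for V
  proof -
    have "((x \<star> y) \<star> z) $ V =
       (\<Sum>S\<in>UNIV. \<Sum>U\<in>UNIV. blade_sign U (symdiff U V) * (blade_sign S (symdiff S U) * x $ S * y $ symdiff S U) * z $ symdiff U V)"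
      by (subst sum.swap) (simp add: clifford_mult_def sum_distrib_left sum_distrib_right)
    also have "\<dots> = (\<Sum>S\<in>UNIV. \<Sum>W\<in>UNIV. blade_sign S (symdiff S V) * x $ S *
        (blade_sign W (symdiff W (symdiff S V)) * y $ W * z $ symdiff W (symdiff S V)))"
    proof (rule sum.cong[OF refl])
      fix S
      show "(\<Sum>U\<in>UNIV. blade_sign U (symdiff U V) * (blade_sign S (symdiff S U) * x $ S * y $ symdiff S U) * z $ symdiff U V) =
        (\<Sum>W\<in>UNIV. blade_sign S (symdiff S V) * x $ S * (blade_sign W (symdiff W (symdiff S V)) * y $ W * z $ symdiff W (symdiff S V)))"
      proof (rule sum.reindex_bij_witness[of _ "symdiff S" "symdiff S"])
        fix U
        have "blade_sign U (symdiff U V) * blade_sign S (symdiff S U) = blade_sign S (symdiff S V) * blade_sign (symdiff S U) (symdiff (symdiff S U) (symdiff S V))"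
        proof -
          define W X where "W = symdiff S U" and "X = symdiff U V"
          have U: "U = symdiff S W" and V: "symdiff S V = symdiff W X" by (auto simp: W_def X_def symdiff_def)
          have "blade_sign (symdiff S W) X * blade_sign S W = blade_sign S (symdiff W X) * blade_sign W X"
            by (simp add: blade_sign_symdiff_left blade_sign_symdiff_right algebra_simps)
          thus ?thesis by (simp flip: X_def W_def add: V) (simp flip: U)
        qed
        moreover have "symdiff (symdiff S U) (symdiff S V) = symdiff U V" by (auto simp: symdiff_def)
        ultimately show "blade_sign S (symdiff S V) * x $ S *
            (blade_sign (symdiff S U) (symdiff (symdiff S U) (symdiff S V)) * y $ symdiff S U * z $ symdiff (symdiff S U) (symdiff S V)) =
          blade_sign U (symdiff U V) * (blade_sign S (symdiff S U) * x $ S * y $ symdiff S U) * z $ symdiff U V"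
          by (simp add: mult_ac)
      qed auto
    qed
    also have "\<dots> = (x \<star> (y \<star> z)) $ V"
      by (simp add: clifford_mult_def sum_distrib_left)
    finally show ?thesis .
  qed
  thus ?thesis by (simp add: vec_eq_iff)
qed

lemma clifford_mult_blade_right: "(x \<star> blade T) $ U = blade_sign (symdiff U T) T * x $ (symdiff U T)"
proof -
  have "(x \<star> blade T) $ U = (\<Sum>S\<in>UNIV. if S = symdiff U T then blade_sign (symdiff U T) T * x $ (symdiff U T) else 0)"
    unfolding clifford_mult_def vec_lambda_beta
    by (rule sum.cong) (auto simp: axis_def symdiff_def)
  thus ?thesis by simp
qed

lemma clifford_mult_blade_left: "(blade S \<star> x) $ U = blade_sign S (symdiff S U) * x $ (symdiff S U)"
proof -
  have "(blade S \<star> x) $ U = (\<Sum>S'\<in>UNIV. if S' = S then blade_sign S (symdiff S U) * x $ (symdiff S U) else 0)"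
    unfolding clifford_mult_def vec_lambda_beta
    by (rule sum.cong) (auto simp: axis_def)
  thus ?thesis by simp
qed

lemma clifford_mult_one [simp]: "blade {} \<star> x = x" "x \<star> blade {} = x"
  by (simp_all add: vec_eq_iff clifford_mult_blade_left clifford_mult_blade_right)

lemma blade_mult: "blade S \<star> blade T = blade_sign S T *\<^sub>R blade (symdiff S T)"
proof -
  have "(blade S \<star> blade T) $ U = (blade_sign S T *\<^sub>R blade (symdiff S T)) $ U" for U
    unfolding clifford_mult_blade_right
    by (cases "U = symdiff S T") (simp_all add: axis_def, metis symdiff_cancel_right)
  thus ?thesis by (simp add: vec_eq_iff)
qed

text \<open>The reversion, the anti-automorphism that reverses the order of the factors of each \<open>e\<^sub>S\<close>: the
  sign \<open>blade_sign S S\<close> is that of reversing \<open>e\<^sub>S\<close>, as both multiply with \<open>e\<^sub>S\<close> to \<open>1\<close>.\<close>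
definition clifford_rev :: "real^('n::finite set) \<Rightarrow> real^('n set)" where
  "clifford_rev x = (\<chi> S. blade_sign S S * x $ S)"

lemma linear_clifford_rev: "linear clifford_rev"
  by (rule linearI) (simp_all add: clifford_rev_def vec_eq_iff algebra_simps)

lemma clifford_rev_one [simp]: "clifford_rev (blade {}) = blade {}"
  by (auto simp: clifford_rev_def vec_eq_iff axis_def)

lemma clifford_rev_mult: "clifford_rev (x \<star> y) = clifford_rev y \<star> clifford_rev x"
proof -
  have "clifford_rev (x \<star> y) $ V = (clifford_rev y \<star> clifford_rev x) $ V" for V
  proof -
    have "clifford_rev (x \<star> y) $ V = (\<Sum>S\<in>UNIV. blade_sign V V * (blade_sign S (symdiff S V) * x $ S * y $ symdiff S V))"
      by (simp add: clifford_rev_def clifford_mult_def sum_distrib_left)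
    also have "\<dots> = (\<Sum>T\<in>UNIV. blade_sign T (symdiff T V) * (blade_sign T T * y $ T) * (blade_sign (symdiff T V) (symdiff T V) * x $ symdiff T V))"
    proof (rule sum.reindex_bij_witness[of _ "\<lambda>T. symdiff T V" "\<lambda>S. symdiff S V"])
      fix S
      define T where "T = symdiff S V"
      have V: "V = symdiff S T" and e: "symdiff S V = T" "symdiff T V = S" by (auto simp: T_def symdiff_def)
      have "blade_sign V V * blade_sign S T = blade_sign T S * blade_sign T T * blade_sign S S"
        unfolding V by (simp add: blade_sign_symdiff_left blade_sign_symdiff_right mult_ac)
      hence "blade_sign T S * (blade_sign T T * y $ T) * (blade_sign S S * x $ S) =
          blade_sign V V * blade_sign S T * x $ S * y $ T" by simp
      thus "blade_sign (symdiff S V) (symdiff (symdiff S V) V) * (blade_sign (symdiff S V) (symdiff S V) * y $ symdiff S V) *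
          (blade_sign (symdiff (symdiff S V) V) (symdiff (symdiff S V) V) * x $ symdiff (symdiff S V) V) =
        blade_sign V V * (blade_sign S (symdiff S V) * x $ S * y $ symdiff S V)"
        unfolding e by simp
    qed auto
    also have "\<dots> = (clifford_rev y \<star> clifford_rev x) $ V"
      by (simp add: clifford_rev_def clifford_mult_def)
    finally show ?thesis .
  qed
  thus ?thesis by (simp add: vec_eq_iff)
qed

lemma clifford_mult_clifford_rev_scalar: "(x \<star> clifford_rev x) $ {} = x \<bullet> x"
  unfolding clifford_mult_def clifford_rev_def inner_vec_def by (simp add: mult_ac)

definition clifford_vec :: "real^'n \<Rightarrow> real^('n::finite set)" where
  "clifford_vec v = (\<Sum>i\<in>UNIV. v $ i *\<^sub>R blade {i})"

lemma clifford_vec_nth: "clifford_vec v $ S = (\<Sum>i\<in>UNIV. if S = {i} then v $ i else 0)"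
  unfolding clifford_vec_def by (simp add: axis_def if_distrib cong: if_cong)

lemma clifford_vec_singleton [simp]: "clifford_vec v $ {k} = v $ k"
  by (simp add: clifford_vec_nth)

lemma clifford_vec_nonsingleton: "\<nexists>k. S = {k} \<Longrightarrow> clifford_vec v $ S = 0"
  by (auto simp: clifford_vec_nth intro!: sum.neutral)

lemma linear_clifford_vec: "linear clifford_vec"
  unfolding clifford_vec_def
  by (intro linearI) (simp_all add: scaleR_left_distrib sum.distrib scaleR_sum_right)

lemma clifford_vec_axis: "clifford_vec (axis i 1) = blade {i}"
proof -
  have "clifford_vec (axis i 1) $ S = blade {i} $ S" for S
    by (cases "\<exists>k. S = {k}") (auto simp: clifford_vec_nonsingleton, auto simp: axis_def)
  thus ?thesis by (simp add: vec_eq_iff)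
qed

lemma clifford_rev_clifford_vec [simp]: "clifford_rev (clifford_vec v) = clifford_vec v"
proof -
  have "blade_sign S S * clifford_vec v $ S = clifford_vec v $ S" for S
    by (cases "\<exists>k. S = {k}") (auto simp: swap_sign_def clifford_vec_nonsingleton)
  thus ?thesis by (simp add: clifford_rev_def vec_eq_iff)
qed

lemma clifford_vec_anticommute: "clifford_vec u \<star> clifford_vec v + clifford_vec v \<star> clifford_vec u = (2 * (u \<bullet> v)) *\<^sub>R blade {}"
proof -
  have prod: "clifford_vec u \<star> clifford_vec v = (\<Sum>i\<in>UNIV. \<Sum>j\<in>UNIV. (u $ i * v $ j) *\<^sub>R (blade {i} \<star> blade {j}))" for u v
    unfolding clifford_vec_def
    by (simp only: clifford_mult.sum_left)
      (simp only: clifford_mult.sum_right clifford_mult.scaleR_left clifford_mult.scaleR_right scaleR_scaleR mult.commute)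
  have "clifford_vec v \<star> clifford_vec u = (\<Sum>i\<in>UNIV. \<Sum>j\<in>UNIV. (u $ i * v $ j) *\<^sub>R (blade {j} \<star> blade {i}))"
    unfolding prod by (subst sum.swap) (simp only: mult.commute)
  moreover note prod[of u v]
  ultimately have "clifford_vec u \<star> clifford_vec v + clifford_vec v \<star> clifford_vec u =
      (\<Sum>i\<in>UNIV. \<Sum>j\<in>UNIV. (u $ i * v $ j) *\<^sub>R (blade {i} \<star> blade {j} + blade {j} \<star> blade {i}))"
    by (simp add: sum.distrib scaleR_right_distrib)
  also have "\<dots> = (\<Sum>i\<in>UNIV. \<Sum>j\<in>UNIV. if j = i then (2 * (u $ i * v $ i)) *\<^sub>R blade {} else 0)"
  proof (intro sum.cong refl)
    fix i j :: 'a
    show "(u $ i * v $ j) *\<^sub>R (blade {i} \<star> blade {j} + blade {j} \<star> blade {i}) =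
      (if j = i then (2 * (u $ i * v $ i)) *\<^sub>R blade {} else 0)"
      using swap_sign_anti[of i j]
      by (cases "i = j") (auto simp: blade_mult symdiff_commute[of "{j}"] swap_sign_def[of j j] scaleR_2[symmetric])
  qed
  also have "\<dots> = (2 * (u \<bullet> v)) *\<^sub>R blade {}"
    by (simp add: inner_vec_def sum_distrib_left scaleR_sum_left)
  finally show ?thesis .
qed

lemma clifford_vec_square: "clifford_vec u \<star> clifford_vec u = (u \<bullet> u) *\<^sub>R blade {}"
proof -
  have "2 *\<^sub>R (clifford_vec u \<star> clifford_vec u) = 2 *\<^sub>R ((u \<bullet> u) *\<^sub>R blade {})"
    using clifford_vec_anticommute[of u u] by (simp only: scaleR_2 scaleR_scaleR[symmetric])
  thus ?thesis by (rule scaleR_left_imp_eq[rotated]) simp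
qed

text \<open>Anticommuting the last factor past the middle one leaves the formula of the reflection.\<close>
lemma clifford_vec_reflect:
  assumes "norm u = 1"
  shows "clifford_vec u \<star> clifford_vec x \<star> clifford_vec u = - clifford_vec (refl_mat u *v x)"
proof -
  have u: "u \<bullet> u = 1" using assms by (simp add: norm_eq_1)
  have "clifford_vec x \<star> clifford_vec u = (2 * (u \<bullet> x)) *\<^sub>R blade {} - clifford_vec u \<star> clifford_vec x"
    using clifford_vec_anticommute[of u x] by (simp add: eq_diff_eq add.commute)
  hence "clifford_vec u \<star> clifford_vec x \<star> clifford_vec u = (2 * (u \<bullet> x)) *\<^sub>R clifford_vec u - (clifford_vec u \<star> clifford_vec u) \<star> clifford_vec x"
    by (simp add: clifford_mult_assoc clifford_mult.diff_right clifford_mult.scaleR_right)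
  also have "\<dots> = - clifford_vec (refl_mat u *v x)"
    by (simp add: clifford_vec_square u refl_mat_apply linear_diff[OF linear_clifford_vec] linear_scale[OF linear_clifford_vec])
  finally show ?thesis .
qed

definition has_parity :: "bool \<Rightarrow> real^('n::finite set) \<Rightarrow> bool" where
  "has_parity p x \<longleftrightarrow> (\<forall>S. x $ S \<noteq> 0 \<longrightarrow> even (card S) = p)"

lemma has_parity_mult:
  assumes "has_parity p x" "has_parity q y"
  shows "has_parity (p = q) (x \<star> y)"
  unfolding has_parity_def
proof (intro allI impI)
  fix U assume "(x \<star> y) $ U \<noteq> 0"
  then obtain S where "blade_sign S (symdiff S U) * x $ S * y $ (symdiff S U) \<noteq> 0"
    unfolding clifford_mult_def vec_lambda_beta by (meson sum.neutral)
  hence "even (card S) = p" "even (card (symdiff S U)) = q"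
    using assms unfolding has_parity_def by auto
  thus "even (card U) = (p = q)" by (auto simp: even_card_symdiff)
qed

lemma has_parity_clifford_vec: "has_parity False (clifford_vec v)"
  unfolding has_parity_def
proof (intro allI impI)
  fix S assume "clifford_vec v $ S \<noteq> 0"
  then obtain k where "S = {k}" using clifford_vec_nonsingleton by metis
  thus "even (card S) = False" by simp
qed

lemma has_parity_one: "has_parity True (blade {})"
  by (simp add: has_parity_def axis_def)

lemma has_parity_clifford_rev: "has_parity p x \<Longrightarrow> has_parity p (clifford_rev x)"
  by (simp add: has_parity_def clifford_rev_def)

text \<open>If \<open>e\<^sub>S\<close> occurs in \<open>w\<close> for a nonempty even \<open>S\<close>, it anticommutes with every \<open>e\<^sub>i\<close> for \<open>i \<in> S\<close>.\<close>
lemma even_central_imp_scalar: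
  assumes "has_parity True w" "\<And>i. w \<star> blade {i} = blade {i} \<star> w"
  shows "w = w $ {} *\<^sub>R blade {}"
proof -
  have "w $ S = 0" if nonempty: "S \<noteq> {}" for S
  proof (rule ccontr)
    assume ne: "w $ S \<noteq> 0"
    hence ev: "even (card S)" using assms(1) by (simp add: has_parity_def)
    obtain i where i: "i \<in> S" using nonempty by blast
    have "(w \<star> blade {i}) $ (symdiff S {i}) = (blade {i} \<star> w) $ (symdiff S {i})" by (simp add: assms(2))
    hence "blade_sign S {i} * w $ S = blade_sign {i} S * w $ S"
      by (simp add: clifford_mult_blade_left clifford_mult_blade_right symdiff_commute[of S])
    hence "blade_sign S {i} = blade_sign {i} S" using ne by simp
    hence "blade_sign {i} S = 0" using blade_sign_swap[OF i ev] by simp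
    thus False using blade_sign_square[of "{i}" S] by simp
  qed
  thus ?thesis by (auto simp: vec_eq_iff axis_def)
qed

section \<open>The double cover by the spin group\<close>

text \<open>All conditions are closed, so that compactness is immediate. The last one says that conjugation maps
  generators, and hence vectors, to vectors.\<close>
definition spin_group :: "(real^('n::finite set)) set" where
  "spin_group = {z. has_parity True z \<and> z \<star> clifford_rev z = blade {} \<and> clifford_rev z \<star> z = blade {} \<and>
     (\<forall>i S. (\<nexists>k. S = {k}) \<longrightarrow> (z \<star> blade {i} \<star> clifford_rev z) $ S = 0)}"

definition spin_action :: "real^('n::finite set) \<Rightarrow> real^'n^'n" where
  "spin_action z = (\<chi> k i. (z \<star> blade {i} \<star> clifford_rev z) $ {k})"

lemma spin_conj_blade:
  assumes "z \<in> spin_group"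
  shows "z \<star> blade {i} \<star> clifford_rev z = clifford_vec (spin_action z *v axis i 1)"
proof -
  have "(z \<star> blade {i} \<star> clifford_rev z) $ S = clifford_vec (spin_action z *v axis i 1) $ S" for S
  proof (cases "\<exists>k. S = {k}")
    case True
    thus ?thesis by (auto simp: spin_action_def matrix_vector_mult_basis column_def)
  next
    case False
    thus ?thesis using assms unfolding spin_group_def by (simp add: clifford_vec_nonsingleton)
  qed
  thus ?thesis by (simp add: vec_eq_iff)
qed

lemma spin_conj_clifford_vec:
  assumes "z \<in> spin_group"
  shows "z \<star> clifford_vec v \<star> clifford_rev z = clifford_vec (spin_action z *v v)"
proof -
  have "z \<star> clifford_vec v \<star> clifford_rev z = (\<Sum>i\<in>UNIV. v $ i *\<^sub>R (z \<star> blade {i} \<star> clifford_rev z))"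
    unfolding clifford_vec_def
    by (simp only: clifford_mult.sum_right clifford_mult.sum_left clifford_mult.scaleR_right clifford_mult.scaleR_left)
  also have "\<dots> = clifford_vec (\<Sum>i\<in>UNIV. v $ i *\<^sub>R (spin_action z *v axis i 1))"
    by (simp add: spin_conj_blade[OF assms] linear_sum[OF linear_clifford_vec] linear_scale[OF linear_clifford_vec])
  also have "(\<Sum>i\<in>UNIV. v $ i *\<^sub>R (spin_action z *v axis i 1)) = spin_action z *v v"
    by (simp only: matrix_vector_mult_basis)
      (simp add: vec_eq_iff column_def matrix_vector_mult_def mult.commute)
  finally show ?thesis .
qed

lemma spin_groupI:
  assumes "has_parity True z" "z \<star> clifford_rev z = blade {}" "clifford_rev z \<star> z = blade {}"
    and "\<And>v. z \<star> clifford_vec v \<star> clifford_rev z = clifford_vec (A *v v)"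
  shows "z \<in> spin_group" "spin_action z = A"
proof -
  have *: "z \<star> blade {i} \<star> clifford_rev z = clifford_vec (A *v axis i 1)" for i
    using assms(4)[of "axis i 1"] by (simp only: clifford_vec_axis)
  show "z \<in> spin_group"
    unfolding spin_group_def using assms(1-3) by (simp add: * clifford_vec_nonsingleton)
  show "spin_action z = A"
    by (simp add: spin_action_def * vec_eq_iff matrix_vector_mult_basis column_def)
qed

lemma spin_groupD:
  assumes "z \<in> spin_group"
  shows "has_parity True z" "z \<star> clifford_rev z = blade {}" "clifford_rev z \<star> z = blade {}"
  using assms by (auto simp: spin_group_def)

lemma spin_mult:
  assumes "z \<in> spin_group" "w \<in> spin_group"
  shows "z \<star> w \<in> spin_group" "spin_action (z \<star> w) = spin_action z ** spin_action w"
proof -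
  note zw = spin_groupD[OF assms(1)] spin_groupD[OF assms(2)]
  have 1: "has_parity True (z \<star> w)" using has_parity_mult[OF zw(1,4)] by simp
  have "(z \<star> w) \<star> clifford_rev (z \<star> w) = z \<star> (w \<star> clifford_rev w) \<star> clifford_rev z"
    by (simp only: clifford_rev_mult clifford_mult_assoc)
  hence 2: "(z \<star> w) \<star> clifford_rev (z \<star> w) = blade {}" by (simp add: zw)
  have "clifford_rev (z \<star> w) \<star> (z \<star> w) = clifford_rev w \<star> (clifford_rev z \<star> z) \<star> w"
    by (simp only: clifford_rev_mult clifford_mult_assoc)
  hence 3: "clifford_rev (z \<star> w) \<star> (z \<star> w) = blade {}" by (simp add: zw)
  have 4: "(z \<star> w) \<star> clifford_vec v \<star> clifford_rev (z \<star> w) = clifford_vec ((spin_action z ** spin_action w) *v v)" for v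
  proof -
    have "(z \<star> w) \<star> clifford_vec v \<star> clifford_rev (z \<star> w) = z \<star> (w \<star> clifford_vec v \<star> clifford_rev w) \<star> clifford_rev z"
      by (simp only: clifford_rev_mult clifford_mult_assoc)
    thus ?thesis
      by (simp add: spin_conj_clifford_vec assms matrix_vector_mul_assoc)
  qed
  show "z \<star> w \<in> spin_group" "spin_action (z \<star> w) = spin_action z ** spin_action w"
    using spin_groupI[OF 1 2 3 4] by blast+
qed

lemma spin_one: "blade {} \<in> spin_group" "spin_action (blade {}) = mat 1"
proof -
  have "blade {} \<star> clifford_vec v \<star> clifford_rev (blade {}) = clifford_vec (mat 1 *v v)" for v :: "real^'n"
    by simp
  from spin_groupI[OF has_parity_one _ _ this]
  show "blade {} \<in> spin_group" "spin_action (blade {}) = mat 1" by simp_all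
qed

text \<open>The minus signs of the two conjugations by \<open>u\<close> and \<open>v\<close> cancel.\<close>
lemma spin_two_vectors:
  assumes "norm u = 1" "norm v = 1"
  shows "clifford_vec u \<star> clifford_vec v \<in> spin_group" "spin_action (clifford_vec u \<star> clifford_vec v) = refl_mat u ** refl_mat v"
proof -
  let ?z = "clifford_vec u \<star> clifford_vec v"
  have sq: "clifford_vec u \<star> clifford_vec u = blade {}" "clifford_vec v \<star> clifford_vec v = blade {}"
    using assms by (simp_all add: clifford_vec_square norm_eq_1)
  have 1: "has_parity True ?z" using has_parity_mult[OF has_parity_clifford_vec has_parity_clifford_vec, of u v] by simp
  have "?z \<star> clifford_rev ?z = clifford_vec u \<star> (clifford_vec v \<star> clifford_vec v) \<star> clifford_vec u"
    by (simp only: clifford_rev_mult clifford_rev_clifford_vec clifford_mult_assoc)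
  hence 2: "?z \<star> clifford_rev ?z = blade {}" by (simp add: sq)
  have "clifford_rev ?z \<star> ?z = clifford_vec v \<star> (clifford_vec u \<star> clifford_vec u) \<star> clifford_vec v"
    by (simp only: clifford_rev_mult clifford_rev_clifford_vec clifford_mult_assoc)
  hence 3: "clifford_rev ?z \<star> ?z = blade {}" by (simp add: sq)
  have 4: "?z \<star> clifford_vec x \<star> clifford_rev ?z = clifford_vec ((refl_mat u ** refl_mat v) *v x)" for x
  proof -
    have "?z \<star> clifford_vec x \<star> clifford_rev ?z = clifford_vec u \<star> (clifford_vec v \<star> clifford_vec x \<star> clifford_vec v) \<star> clifford_vec u"
      by (simp only: clifford_rev_mult clifford_rev_clifford_vec clifford_mult_assoc)
    also have "\<dots> = clifford_vec ((refl_mat u ** refl_mat v) *v x)"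
      by (simp add: clifford_vec_reflect assms clifford_mult.minus_left clifford_mult.minus_right flip: matrix_vector_mul_assoc)
    finally show ?thesis .
  qed
  show "?z \<in> spin_group" "spin_action ?z = refl_mat u ** refl_mat v"
    using spin_groupI[OF 1 2 3 4] by blast+
qed

lemma spin_uminus:
  assumes "z \<in> spin_group"
  shows "- z \<in> spin_group" "spin_action (- z) = spin_action z"
  using assms
  by (simp_all add: spin_group_def spin_action_def linear_neg[OF linear_clifford_rev] clifford_mult.minus_left
      clifford_mult.minus_right has_parity_def)

text \<open>If two elements act alike, their quotient commutes with all generators and is even, so it is a
  scalar, and by the normalisation it is \<open>1\<close> or \<open>-1\<close>.\<close>
lemma spin_action_eq_iff:
  assumes "z \<in> spin_group" "w \<in> spin_group"
  shows "spin_action z = spin_action w \<longleftrightarrow> w = z \<or> w = - z"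
proof
  assume eq: "spin_action z = spin_action w"
  note zw = spin_groupD[OF assms(1)] spin_groupD[OF assms(2)]
  let ?x = "clifford_rev z \<star> w"
  have par: "has_parity True ?x"
    using has_parity_mult[OF has_parity_clifford_rev[OF zw(1)] zw(4)] by simp
  have "?x \<star> blade {i} = blade {i} \<star> ?x" for i
  proof -
    have "z \<star> blade {i} \<star> clifford_rev z = w \<star> blade {i} \<star> clifford_rev w"
      by (simp add: spin_conj_blade assms eq)
    hence "clifford_rev z \<star> (z \<star> blade {i} \<star> clifford_rev z) \<star> w = clifford_rev z \<star> (w \<star> blade {i} \<star> clifford_rev w) \<star> w"
      by simp
    hence "(clifford_rev z \<star> z) \<star> blade {i} \<star> (clifford_rev z \<star> w) = (clifford_rev z \<star> w) \<star> blade {i} \<star> (clifford_rev w \<star> w)"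
      by (simp only: clifford_mult_assoc)
    thus ?thesis by (simp add: zw)
  qed
  then obtain c where c: "?x = c *\<^sub>R blade {}"
    using even_central_imp_scalar[OF par] by blast
  have w: "w = c *\<^sub>R z"
  proof -
    have "w = (z \<star> clifford_rev z) \<star> w" by (simp add: zw)
    also have "\<dots> = z \<star> ?x" by (simp only: clifford_mult_assoc)
    finally show ?thesis by (simp add: c clifford_mult.scaleR_right)
  qed
  have "blade {} = w \<star> clifford_rev w" by (simp add: zw)
  also have "\<dots> = (c * c) *\<^sub>R (z \<star> clifford_rev z)"
    by (simp add: w linear_scale[OF linear_clifford_rev] clifford_mult.scaleR_left clifford_mult.scaleR_right)
  finally have "blade {} $ {} = ((c * c) *\<^sub>R blade {}) $ ({} :: 'a set)" by (simp add: zw)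
  hence "c * c = 1" by (simp add: axis_def)
  hence "c = 1 \<or> c = -1" by (simp add: square_eq_1_iff)
  thus "w = z \<or> w = - z" using w by auto
qed (use spin_uminus[OF assms(1)] in auto)

lemma spin_norm:
  assumes "z \<in> spin_group"
  shows "norm z = 1"
proof -
  have "z \<bullet> z = 1" using spin_groupD(2)[OF assms] clifford_mult_clifford_rev_scalar[of z] by (simp add: axis_def)
  thus ?thesis by (simp add: norm_eq_1)
qed

lemma continuous_on_clifford_rev:
  fixes f :: "'a::euclidean_space \<Rightarrow> real^('n::finite set)"
  shows "continuous_on S f \<Longrightarrow> continuous_on S (\<lambda>x. clifford_rev (f x))"
  by (rule linear_continuous_on_compose[OF _ linear_clifford_rev])

lemma continuous_on_spin_action: "continuous_on S spin_action"
  unfolding spin_action_def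
  by (intro continuous_on_vec_lambda continuous_on_component clifford_mult.continuous_on continuous_on_clifford_rev
      continuous_on_id continuous_on_const)

lemma compact_spin_group: "compact (spin_group :: (real^('n::finite set)) set)"
proof -
  have "closed {z :: real^('n set). has_parity True z}"
    unfolding has_parity_def
  proof (intro closed_Collect_all)
    fix S :: "'n set"
    have *: "(z $ S \<noteq> 0 \<longrightarrow> even (card S) = True) \<longleftrightarrow> z $ S = 0 \<or> even (card S)" for z :: "real^('n set)" by auto
    show "closed {z :: real^('n set). z $ S \<noteq> 0 \<longrightarrow> even (card S) = True}"
      unfolding * by (cases "even (card S)") (auto intro!: closed_Collect_eq continuous_intros)
  qed
  moreover have "closed {z :: real^('n set). z \<star> clifford_rev z = blade {}}" "closed {z :: real^('n set). clifford_rev z \<star> z = blade {}}"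
    by (intro closed_Collect_eq clifford_mult.continuous_on continuous_on_clifford_rev continuous_on_id continuous_on_const)+
  moreover have "closed {z :: real^('n set). \<forall>i S. (\<nexists>k. S = {k}) \<longrightarrow> (z \<star> blade {i} \<star> clifford_rev z) $ S = 0}"
    by (intro closed_Collect_all closed_Collect_imp open_Collect_const closed_Collect_eq
        continuous_on_component clifford_mult.continuous_on continuous_on_clifford_rev continuous_on_id continuous_on_const)
  ultimately have "closed (spin_group :: (real^('n set)) set)"
    unfolding spin_group_def by (intro closed_Collect_conj)
  moreover have "bounded (spin_group :: (real^('n set)) set)"
    by (rule boundedI[of _ 1]) (simp add: spin_norm)
  ultimately show ?thesis by (simp add: compact_eq_bounded_closed)
qed

text \<open>By compactness the map is open: the image of an open set is the complement of the image of the compact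
  set of points for which neither they nor their antipodes lie in it. The points that are not orthogonal
  to a given \<open>z\<close> split into two open halves which \<open>p\<close> maps injectively to the same set; these are
  the two sheets over a neighbourhood of \<open>p z\<close>.\<close>
lemma covering_space_antipodal:
  fixes p :: "'a::euclidean_space \<Rightarrow> 'b::t2_space"
  assumes C: "compact C" "0 \<notin> C" "\<And>z. z \<in> C \<Longrightarrow> - z \<in> C"
    and p: "continuous_on C p" "\<And>z w. z \<in> C \<Longrightarrow> w \<in> C \<Longrightarrow> p z = p w \<longleftrightarrow> w = z \<or> w = - z"
  shows "covering_space C p (p ` C)"
proof
  have open_map: "openin (top_of_set (p ` C)) (p ` W)" if W: "openin (top_of_set C) W" for W
  proof -
    obtain U where U: "open U" "W = C \<inter> U" using W by (auto simp: openin_open)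
    let ?D = "C - (U \<union> uminus ` U)"
    have "open (U \<union> uminus ` U)" using U(1) open_negations by blast
    hence "compact ?D" using C(1) by (rule compact_diff[rotated])
    hence "compact (p ` ?D)"
      using p(1) by (intro compact_continuous_image) (auto intro: continuous_on_subset)
    hence "closed (p ` ?D)" by (rule compact_imp_closed)
    moreover have "p ` W = p ` C \<inter> - (p ` ?D)"
    proof (intro Set.set_eqI iffI)
      fix y assume "y \<in> p ` W"
      then obtain w where w: "w \<in> C" "w \<in> U" "y = p w" using U(2) by auto
      have "y \<noteq> p z" if "z \<in> ?D" for z
      proof
        assume "y = p z"
        hence "z = w \<or> z = - w" using p(2)[of w z] w that by auto
        thus False using that w(2) by auto
      qed
      thus "y \<in> p ` C \<inter> - (p ` ?D)" using w by auto
    next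
      fix y assume y: "y \<in> p ` C \<inter> - (p ` ?D)"
      then obtain z where z: "z \<in> C" "y = p z" by auto
      have "z \<in> U \<or> - z \<in> U"
      proof (rule ccontr)
        assume "\<not> (z \<in> U \<or> - z \<in> U)"
        hence "z \<in> ?D" using z(1) by auto
        thus False using y z(2) by blast
      qed
      moreover have "p (- z) = p z" using p(2)[of "- z" z] C(3) z(1) by auto
      ultimately have "z \<in> W \<or> - z \<in> W" "y = p (- z)" using z C(3)[OF z(1)] U(2) by auto
      thus "y \<in> p ` W" using z(2) by blast
    qed
    ultimately show ?thesis by (auto simp: openin_open intro!: exI[of _ "- (p ` ?D)"])
  qed
  fix x assume "x \<in> p ` C"
  then obtain z where z: "z \<in> C" "x = p z" by auto
  define H where "H e = {w \<in> C. e * (w \<bullet> z) > 0}" for e :: real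
  let ?T = "p ` (H 1 \<union> H (-1))"
  have oH: "openin (top_of_set C) (H e)" for e
  proof -
    have "open {w. e * (w \<bullet> z) > 0}" by (intro open_Collect_less continuous_intros)
    moreover have "H e = C \<inter> {w. e * (w \<bullet> z) > 0}" by (auto simp: H_def)
    ultimately show ?thesis by (auto simp: openin_open)
  qed
  have neg: "- w \<in> H e \<longleftrightarrow> w \<in> H (- e)" for w e
    using C(3)[of w] C(3)[of "- w"] by (auto simp: H_def)
  have pneg: "p (- w) = p w" if "w \<in> C" for w using p(2)[of "- w" w] C(3) that by auto
  have Hsub: "H e \<subseteq> C" for e by (auto simp: H_def)
  have pH: "p ` H e = ?T" if "e = 1 \<or> e = -1" for e
  proof -
    have "p ` H (- e) \<subseteq> p ` H e"
    proof
      fix y assume "y \<in> p ` H (- e)"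
      then obtain w where w: "w \<in> H (- e)" "y = p w" by auto
      hence "y = p (- w)" "- w \<in> H e" using pneg[of w] subsetD[OF Hsub w(1)] neg by simp_all
      thus "y \<in> p ` H e" by blast
    qed
    thus ?thesis using that by auto
  qed
  have hom: "\<exists>q. homeomorphism (H e) ?T p q" if e: "e = 1 \<or> e = -1" for e
  proof (rule homeomorphism_injective_open_map[OF _ pH[OF e]])
    show "continuous_on (H e) p" using p(1) Hsub by (rule continuous_on_subset)
    show "inj_on p (H e)"
    proof (rule inj_onI)
      fix u v assume u: "u \<in> H e" and v: "v \<in> H e" and "p u = p v"
      hence "v = u \<or> v = - u" using p(2)[of u v] Hsub by blast
      moreover have "v \<noteq> - u" using u v by (auto simp: H_def)
      ultimately show "u = v" by simp
    qed
    show "openin (top_of_set ?T) (p ` U)" if U: "openin (top_of_set (H e)) U" for U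
    proof -
      have "openin (top_of_set C) U" using U oH by (rule openin_trans)
      hence "openin (top_of_set (p ` C)) (p ` U)" by (rule open_map)
      moreover have "p ` U \<subseteq> ?T" using openin_imp_subset[OF U] pH[OF e] by blast
      ultimately show ?thesis using Hsub by (blast intro: openin_subset_trans)
    qed
  qed blast
  have "openin (top_of_set C) (H 1 \<union> H (-1))" by (intro openin_Un oH)
  hence oT: "openin (top_of_set (p ` C)) ?T" by (rule open_map)
  have "z \<bullet> z > 0" using z(1) C(2) by (metis inner_gt_zero_iff)
  hence "x \<in> ?T" using z by (auto simp: H_def)
  moreover have "\<Union>{H 1, H (-1)} = C \<inter> p -` ?T"
  proof (intro Set.set_eqI iffI)
    fix w assume "w \<in> C \<inter> p -` ?T"
    then obtain u where w: "w \<in> C" and u: "u \<in> H 1 \<union> H (-1)" "p w = p u" by auto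
    hence "u = w \<or> u = - w" using p(2)[of w u] Hsub by blast
    thus "w \<in> \<Union>{H 1, H (-1)}" using u neg[of w 1] neg[of w "-1"] by auto
  qed (use Hsub in auto)
  moreover have "pairwise disjnt {H 1, H (-1)}"
    by (auto simp: pairwise_def disjnt_def H_def)
  ultimately show "\<exists>T. x \<in> T \<and> openin (top_of_set (p ` C)) T \<and> (\<exists>v. \<Union>v = C \<inter> p -` T \<and>
      (\<forall>u\<in>v. openin (top_of_set C) u) \<and> pairwise disjnt v \<and> (\<forall>u\<in>v. \<exists>q. homeomorphism u T p q))"
    using oT oH hom by (intro exI[of _ ?T] conjI exI[of _ "{H 1, H (-1)}"]) auto
qed (use p in auto)

lemma covering_space_spin: "covering_space spin_group spin_action (spin_action ` spin_group)"
proof (rule covering_space_antipodal)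
  show "0 \<notin> (spin_group :: (real^('a set)) set)" using spin_norm by fastforce
qed (simp_all add: compact_spin_group spin_uminus continuous_on_spin_action spin_action_eq_iff)

lemma refl_mat_sgn: "refl_mat (sgn a) = refl_mat a"
  by (cases "a = 0") (simp_all add: refl_mat_def sgn_div_norm vec_eq_iff)

lemma two_reflections_in_spin_image:
  assumes "a \<noteq> 0" "b \<noteq> 0"
  shows "refl_mat a ** refl_mat b \<in> spin_action ` spin_group"
  using spin_two_vectors[of "sgn a" "sgn b"] assms by (metis image_eqI norm_sgn refl_mat_sgn)

text \<open>The argument of Cartan and Dieudonne: if \<open>e\<^sub>i\<close> is moved, the reflection in the difference of \<open>e\<^sub>i\<close> and
  its image brings it back without disturbing the basis vectors that are already fixed. Counting
  reflections modulo two is done by the alternative that either the matrix or all its products with one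
  more reflection lie in the image.\<close>
lemma SO_subset_spin_image: "SO \<subseteq> spin_action ` (spin_group :: (real^('n::finite set)) set)"
proof
  \<comment> \<open>The determinant is recorded to exclude the second alternative for rotations.\<close>
  define P where "P = {A \<in> spin_action ` (spin_group :: (real^('n set)) set). det A = 1}"
  have P_mult: "A ** B \<in> P" if AB: "A \<in> P" "B \<in> P" for A B
  proof -
    obtain z w where "z \<in> spin_group" "A = spin_action z" "w \<in> spin_group" "B = spin_action w"
      using AB unfolding P_def by blast
    hence "A ** B \<in> spin_action ` spin_group" using spin_mult[of z w] by (metis image_eqI)
    thus ?thesis using that by (simp add: P_def det_mul)
  qed
  have P_refl: "refl_mat a ** refl_mat b \<in> P" if "a \<noteq> 0" "b \<noteq> 0" for a b
    using two_reflections_in_spin_image[OF that] that by (simp add: P_def det_mul det_refl_mat)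
  have P_1: "mat 1 \<in> P" 
  proof -
    have "mat 1 \<in> spin_action ` (spin_group :: (real^('n set)) set)"
      by (rule image_eqI[of _ _ "blade {}"]) (simp_all add: spin_one)
    thus ?thesis by (simp add: P_def)
  qed
  have main: "A \<in> P \<or> (\<forall>b. b \<noteq> 0 \<longrightarrow> refl_mat b ** A \<in> P)"
    if "finite F" "orthogonal_matrix A" "\<forall>j. j \<notin> F \<longrightarrow> A *v axis j 1 = axis j 1" for F and A :: "real^'n^'n"
    using that
  proof (induction F arbitrary: A)
    case empty
    hence "A = mat 1" by (intro matrix_eq_on_axes) simp
    thus ?case using P_1 by simp
  next
    case (insert i F)
    let ?u = "A *v axis i 1"
    show ?case
    proof (cases "?u = axis i 1")
      case True
      hence "\<forall>j. j \<notin> F \<longrightarrow> A *v axis j 1 = axis j 1"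
        using insert.prems(2) by (metis insert_iff)
      thus ?thesis using insert.IH[of A] insert.prems(1) by blast
    next
      case False
      define a where "a = ?u - axis i 1"
      have a: "a \<noteq> 0" using False by (simp add: a_def)
      note orth = insert.prems(1)
      have aa: "a \<bullet> a = 2 * (a \<bullet> ?u)"
        using orthogonal_matrix_inner[OF orth, of "axis i 1" "axis i 1"]
        by (simp add: a_def inner_diff_left inner_diff_right inner_axis_axis inner_commute)
      let ?A = "refl_mat a ** A"
      have "?A *v axis i 1 = ?u - a"
        using aa a by (simp add: refl_mat_apply flip: matrix_vector_mul_assoc aa)
      hence fix_i: "?A *v axis i 1 = axis i 1" by (simp add: a_def)
      have "?A *v axis j 1 = axis j 1" if "j \<notin> F" for j
      proof (cases "j = i")
        case False
        hence Aj: "A *v axis j 1 = axis j 1" using that insert.prems(2) by simp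
        have "?u \<bullet> axis j 1 = ?u \<bullet> (A *v axis j 1)" by (simp add: Aj)
        also have "\<dots> = 0" using False by (simp add: orthogonal_matrix_inner[OF orth] inner_axis_axis)
        finally have "a \<bullet> axis j 1 = 0" using False by (simp add: a_def inner_diff_left inner_axis_axis)
        thus ?thesis by (simp add: Aj refl_mat_apply flip: matrix_vector_mul_assoc)
      qed (use fix_i in simp)
      moreover have "orthogonal_matrix ?A"
        using orth by (intro orthogonal_matrix_mul orthogonal_refl_mat)
      ultimately consider "?A \<in> P" | "\<forall>b. b \<noteq> 0 \<longrightarrow> refl_mat b ** ?A \<in> P"
        using insert.IH[of ?A] by blast
      thus ?thesis
      proof cases
        case 1
        have "refl_mat b ** A \<in> P" if "b \<noteq> 0" for b
        proof -
          have "refl_mat b ** A = (refl_mat b ** refl_mat a) ** ?A"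
            by (metis matrix_mul_assoc matrix_mul_lid refl_mat_involution)
          thus ?thesis using P_mult[OF P_refl[OF that a] 1] by simp
        qed
        thus ?thesis by blast
      next
        case 2
        hence "refl_mat a ** ?A \<in> P" using a by blast
        thus ?thesis by (simp add: matrix_mul_assoc)
      qed
    qed
  qed
  fix A :: "real^'n^'n" assume A: "A \<in> SO"
  fix k :: 'n
  have k: "axis k (1::real) \<noteq> 0" by (simp add: axis_eq_0_iff)
  have "A \<in> P \<or> refl_mat (axis k 1) ** A \<in> P"
    using main[of UNIV A] k SO_orthogonal[OF A] by auto
  moreover have "refl_mat (axis k 1) ** A \<notin> P"
    using A k by (simp add: P_def det_mul det_refl_mat SO_def rotation_matrix_def)
  ultimately show "A \<in> spin_action ` spin_group" unfolding P_def by blast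
qed

text \<open>The product of the unit vector at half the angle with \<open>e\<^sub>a\<close> is a lift of the full turn. It runs from
  \<open>1\<close> to \<open>-1\<close>, while lifts of homotopic paths with the same start have the same end.\<close>
lemma full_turn_not_null_homotopic:
  fixes a b :: "'n::finite"
  assumes "a \<noteq> b"
  shows "\<not> homotopic_paths SO (\<lambda>t. plane_rotation a b (2 * pi * t)) (\<lambda>t. mat 1)"
proof
  assume hom: "homotopic_paths SO (\<lambda>t. plane_rotation a b (2 * pi * t)) (\<lambda>t. mat 1)"
  define u :: "real \<Rightarrow> real^'n" where "u t = cos (pi * t) *\<^sub>R axis a 1 + sin (pi * t) *\<^sub>R axis b 1" for t
  define z where "z t = clifford_vec (u t) \<star> clifford_vec (axis a 1)" for t
  let ?S = "spin_group :: (real^('n set)) set"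
  have u: "norm (u t) = 1" for t
    using assms sin_cos_squared_add3[of "pi * t"]
    by (simp add: u_def norm_eq_1 inner_add_left inner_add_right inner_axis_axis)
  have z: "z t \<in> ?S" "spin_action (z t) = plane_rotation a b (2 * pi * t)" for t
    using spin_two_vectors[OF u[of t], of "axis a 1"] plane_rotation_conv_reflections[OF assms, of "pi * t"]
    by (simp_all add: z_def u_def mult.assoc)
  have cu: "continuous_on {0..1} u" unfolding u_def by (intro continuous_intros)
  have "continuous_on {0..1} (\<lambda>t. clifford_vec (u t))"
    using linear_continuous_on_compose[OF cu linear_clifford_vec] .
  hence "path z" unfolding path_def z_def by (intro clifford_mult.continuous_on continuous_on_const)
  have "pathfinish z = pathfinish (\<lambda>t. blade {})"
  proof (rule covering_space_monodromy[OF covering_space_spin])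
    show "homotopic_paths (spin_action ` ?S) (\<lambda>t. plane_rotation a b (2 * pi * t)) (\<lambda>t. mat 1)"
      using hom SO_subset_spin_image by (rule homotopic_paths_subset)
    thus "path (\<lambda>t. plane_rotation a b (2 * pi * t))" "path (\<lambda>t. mat 1 :: real^'n^'n)"
      "path_image (\<lambda>t. plane_rotation a b (2 * pi * t)) \<subseteq> spin_action ` ?S"
      "path_image (\<lambda>t. mat 1) \<subseteq> spin_action ` ?S"
      using homotopic_paths_imp_path homotopic_paths_imp_subset by blast+
    show "path z" by fact
    show "path_image z \<subseteq> ?S" using z by (auto simp: path_image_def)
    show "spin_action (z t) = plane_rotation a b (2 * pi * t)" for t by (rule z)
    show "path (\<lambda>t. blade {} :: real^('n set))" by (simp add: path_def)
    show "path_image (\<lambda>t. blade {}) \<subseteq> ?S" using spin_one by (auto simp: path_image_def)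
    show "spin_action (blade {} :: real^('n set)) = mat 1" by (rule spin_one)
    show "pathstart z = pathstart (\<lambda>t. blade {})"
      by (simp add: pathstart_def z_def u_def clifford_vec_square inner_axis_axis)
  qed
  moreover have "z 1 = - blade {}"
    by (simp add: z_def u_def linear_neg[OF linear_clifford_vec] clifford_mult.minus_left clifford_vec_square inner_axis_axis)
  ultimately have "- blade {} = (blade {} :: real^('n set))" by (simp only: pathfinish_def)
  hence "(- blade {}) $ ({} :: 'n set) = blade {} $ ({} :: 'n set)" by (rule arg_cong[where f = "\<lambda>x. x $ {}"])
  thus False by (simp add: axis_def)
qed

section \<open>Classification of the loops\<close>

lemma full_turns:
  fixes a b :: "'n::finite"
  shows "plane_rotation a b (2 * pi * of_int k) = mat 1"
proof -
  have *: "sin (2 * pi * of_int k) = 0" "cos (2 * pi * of_int k) = 1"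
    using sin_int_2pin[of k] cos_int_2pin[of k] by (simp_all add: mult_ac)
  have "plane_rotation a b (2 * pi * of_int k) = plane_rotation a b 0"
    by (simp only: plane_rotation_def * sin_zero cos_zero)
  thus ?thesis by (simp only: plane_rotation_0)
qed

text \<open>Conjugation by the half turn in the plane \<open>b c\<close> fixes \<open>e\<^sub>a\<close> and negates \<open>e\<^sub>b\<close>, so it reverses
  the rotations of the plane \<open>a b\<close>. A path to the half turn gives the homotopy.\<close>
lemma homotopic_reverse_turn:
  fixes a b c :: "'n::finite"
  assumes abc: "a \<noteq> b" "a \<noteq> c" "b \<noteq> c"
  shows "homotopic_paths SO (\<lambda>t. plane_rotation a b (2 * pi * of_int k * t))
           (\<lambda>t. plane_rotation a b (- (2 * pi * of_int k * t)))"
proof -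
  let ?r = "\<lambda>t. plane_rotation a b (2 * pi * of_int k * t)"
  let ?C = "\<lambda>s. plane_rotation b c (pi * s)"
  let ?C' = "\<lambda>s. plane_rotation b c (- (pi * s))"
  have flip: "?C 1 ** plane_rotation a b x ** ?C' 1 = plane_rotation a b (- x)" for x
  proof (rule matrix_eq_on_axes)
    fix i
    have C: "?C 1 *v axis b 1 = - axis b 1" "?C' 1 *v axis b 1 = - axis b 1"
      "?C 1 *v axis c 1 = - axis c 1" "?C' 1 *v axis c 1 = - axis c 1"
      using abc by (simp_all add: plane_rotation_first plane_rotation_second)
    have neg: "A *v (- v) = - (A *v v)" for A :: "real^'n^'n" and v
      by (rule vec.neg)
    note lin = matrix_vector_right_distrib matrix_vector_mult_diff_distrib matrix_vector_mult_scaleR neg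
    note fixed = plane_rotation_fixes
    consider "i = a" | "i = b" | "i = c" | "i \<notin> {a, b, c}" by blast
    thus "(?C 1 ** plane_rotation a b x ** ?C' 1) *v axis i 1 = plane_rotation a b (- x) *v axis i 1"
      by cases (use abc in \<open>auto simp: C[simplified] lin fixed plane_rotation_first plane_rotation_second
          simp flip: matrix_vector_mul_assoc\<close>)
  qed
  have "continuous_on ({0..1} \<times> {0..1}) (\<lambda>x. ?C (fst x) ** ?r (snd x) ** ?C' (fst x))"
    by (intro continuous_intros)
  moreover have "?C 0 ** ?r t ** ?C' 0 = ?r t" for t by (simp add: plane_rotation_0)
  ultimately show ?thesis
    unfolding homotopic_paths
    by (intro exI[of _ "\<lambda>x. ?C (fst x) ** ?r (snd x) ** ?C' (fst x)"])
      (use abc in \<open>simp add: flip[simplified] full_turns plane_rotation_0 plane_rotation_mult SO_mult plane_rotation_in_SO pathstart_def pathfinish_def\<close>)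
qed


text \<open>Twice the number of turns is the pointwise square of the loop, and one of the two factors can be
  reversed.\<close>
lemma even_turns_null_homotopic:
  fixes a b c :: "'n::finite"
  assumes "a \<noteq> b" "a \<noteq> c" "b \<noteq> c"
  shows "homotopic_paths SO (\<lambda>t. plane_rotation a b (2 * pi * of_int (2 * k) * t)) (\<lambda>t. mat 1)"
proof -
  let ?r = "\<lambda>t. plane_rotation a b (2 * pi * of_int k * t)"
  have rev: "homotopic_paths SO ?r (\<lambda>t. plane_rotation a b (- (2 * pi * of_int k * t)))"
    by (rule homotopic_reverse_turn[OF assms])
  have "homotopic_paths SO ?r ?r"
    using homotopic_paths_trans[OF rev] rev homotopic_paths_sym by blast
  from homotopic_paths_SO_mult[OF this rev] show ?thesis
    using assms by (simp add: plane_rotation_mult plane_rotation_0 algebra_simps)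
qed

lemma loop_dichotomy:
  fixes a b c :: "'n::finite"
  assumes "a \<noteq> b" "a \<noteq> c" "b \<noteq> c" and g: "rot_path g" "g 1 = mat 1"
  shows "homotopic_paths SO g (\<lambda>t. mat 1) \<or> homotopic_paths SO g (\<lambda>t. plane_rotation a b (2 * pi * t))"
proof -
  obtain g' where g': "homotopic_paths SO g g'" "path_image g' \<subseteq> SO_on {a, b}"
    using loop_reduce_to_plane[OF assms(1), of g] g unfolding rot_path_def by blast
  have "path g'" "g' 0 = mat 1" "g' 1 = mat 1"
    using homotopic_paths_imp_path[OF g'(1)] homotopic_paths_imp_pathstart[OF g'(1)]
      homotopic_paths_imp_pathfinish[OF g'(1)] g
    by (auto simp: rot_path_def pathstart_def pathfinish_def)
  then obtain m :: int where m: "homotopic_paths SO g' (\<lambda>t. plane_rotation a b (2 * pi * m * t))"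
    using loop_in_plane[OF assms(1) _ g'(2)] by blast
  have gm: "homotopic_paths SO g (\<lambda>t. plane_rotation a b (2 * pi * m * t))"
    using g'(1) m by (rule homotopic_paths_trans)
  show ?thesis
  proof (cases "even m")
    case True
    then obtain k where "m = 2 * k" by blast
    thus ?thesis using homotopic_paths_trans[OF gm] even_turns_null_homotopic[OF assms(1-3), of k] by blast
  next
    case False
    then obtain k where k: "m = 2 * k + 1" by (rule oddE)
    have "homotopic_paths SO (\<lambda>t. plane_rotation a b (2 * pi * t)) (\<lambda>t. plane_rotation a b (2 * pi * t))"
      by (intro homotopic_plane_rotations assms continuous_intros) auto
    from homotopic_paths_SO_mult[OF even_turns_null_homotopic[OF assms(1-3), of k] this]
    have "homotopic_paths SO (\<lambda>t. plane_rotation a b (2 * pi * m * t)) (\<lambda>t. plane_rotation a b (2 * pi * t))"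
      using assms(1) by (simp add: plane_rotation_mult k algebra_simps)
    thus ?thesis using homotopic_paths_trans[OF gm] by blast
  qed
qed

section \<open>The group of classes and its action on the vertices\<close>

lemma path_class_eq_iff:
  assumes "path p" "path_image p \<subseteq> T"
  shows "path_class T p = path_class T q \<longleftrightarrow> homotopic_paths T p q"
proof
  assume "path_class T p = path_class T q"
  moreover have "p \<in> path_class T p" using assms by (simp add: path_class_def)
  ultimately show "homotopic_paths T p q" by (auto simp: path_class_def homotopic_paths_sym)
next
  assume "homotopic_paths T p q"
  thus "path_class T p = path_class T q"
    unfolding path_class_def by (blast intro: homotopic_paths_trans homotopic_paths_sym)
qed

lemma rot_path_class_eq_iff:
  "rot_path R \<Longrightarrow> path_class SO R = path_class SO S \<longleftrightarrow> homotopic_paths SO R S"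
  by (simp add: rot_path_def path_class_eq_iff)

lemma mem_path_class: "rot_path R \<Longrightarrow> R \<in> path_class SO R"
  by (simp add: path_class_def rot_path_def)

lemma class_end_path_class:
  assumes "rot_path R"
  shows "class_end (path_class SO R) = R 1"
proof -
  have "pathfinish ` path_class SO R = {R 1}"
    using mem_path_class[OF assms] homotopic_paths_imp_pathfinish[of SO R]
    by (fastforce simp: path_class_def pathfinish_def)
  thus ?thesis by (simp add: class_end_def)
qed

text \<open>Both group structures are unions over representatives; this reduces them to pointwise products.\<close>
lemma Union_path_class_product:
  assumes R: "rot_path R" and S: "rot_path S"
    and op: "\<And>R' S'. homotopic_paths SO R R' \<Longrightarrow> homotopic_paths SO S S' \<Longrightarrow>
      homotopic_paths SO (\<lambda>t. R' t ** S' t) (f R' S')"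
  shows "(\<Union>R'\<in>path_class SO R. \<Union>S'\<in>path_class SO S. path_class SO (f R' S')) =
    path_class SO (\<lambda>t. R t ** S t)"
proof -
  have "path_class SO (f R' S') = path_class SO (\<lambda>t. R t ** S t)"
    if "R' \<in> path_class SO R" "S' \<in> path_class SO S" for R' S'
  proof -
    have h: "homotopic_paths SO R R'" "homotopic_paths SO S S'" using that by (auto simp: path_class_def)
    have "homotopic_paths SO (\<lambda>t. R t ** S t) (f R' S')"
      using homotopic_paths_SO_mult[OF h] op[OF h] by (rule homotopic_paths_trans)
    thus ?thesis by (metis rot_path_class_eq_iff[OF rot_path_pointwise[OF R S]])
  qed
  moreover have "R \<in> path_class SO R" "S \<in> path_class SO S" using R S by (simp_all add: mem_path_class)
  ultimately show ?thesis by blast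
qed

lemma hyper_G_mult:
  assumes "rot_path R" "rot_path S"
  shows "path_class SO R \<otimes>\<^bsub>hyper_G\<^esub> path_class SO S = path_class SO (\<lambda>t. R t ** S t)"
  unfolding hyper_G_def monoid.simps
  by (rule Union_path_class_product[OF assms])
    (use assms rot_path_homotopic rot_path_mult_homotopic_pointwise in blast)

lemma fundamental_group_mult:
  assumes "rot_path p" "p 1 = mat 1" "rot_path q"
  shows "path_class SO p \<otimes>\<^bsub>fundamental_group SO (mat 1)\<^esub> path_class SO q = path_class SO (\<lambda>t. p t ** q t)"
  unfolding fundamental_group_def monoid.simps
proof (rule Union_path_class_product[OF assms(1,3)])
  fix p' q' assume h: "homotopic_paths SO p p'" "homotopic_paths SO q q'"
  have "p' 1 = mat 1" using homotopic_paths_imp_pathfinish[OF h(1)] assms(2) by (simp add: pathfinish_def)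
  thus "homotopic_paths SO (\<lambda>t. p' t ** q' t) (p' +++ q')"
    using h assms rot_path_homotopic by (intro join_homotopic_pointwise) blast+
qed

lemma rot_hyper_group_mult:
  assumes "A \<in> rot_hyper_group" "B \<in> rot_hyper_group"
  shows "A ** B \<in> rot_hyper_group"
proof -
  have "bij_betw ((\<lambda>v. A *v v) \<circ> (\<lambda>v. B *v v)) hyper_vertices hyper_vertices"
    using assms unfolding rot_hyper_group_def by (intro bij_betw_trans) auto
  thus ?thesis using assms by (simp add: rot_hyper_group_def SO_mult o_def matrix_vector_mul_assoc)
qed

lemma mat_1_in_rot_hyper_group: "mat 1 \<in> rot_hyper_group"
  by (simp add: rot_hyper_group_def mat_1_in_SO bij_betw_def inj_on_def)

lemma rot_hyper_group_transpose:
  assumes "A \<in> rot_hyper_group"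
  shows "transpose A \<in> rot_hyper_group"
proof -
  have A: "A \<in> SO" "bij_betw (\<lambda>v. A *v v) hyper_vertices hyper_vertices"
    using assms by (auto simp: rot_hyper_group_def)
  have inv: "transpose A *v (A *v v) = v" "A *v (transpose A *v v) = v" for v
    by (simp_all only: matrix_vector_mul_assoc SO_inverse[OF A(1)] matrix_vector_mul_lid)
  have im: "(\<lambda>v. A *v v) ` hyper_vertices = hyper_vertices" using A(2) by (simp add: bij_betw_def)
  have "(\<lambda>v. transpose A *v v) ` hyper_vertices \<subseteq> hyper_vertices"
    by (subst (1) im[symmetric]) (auto simp: inv simp del: transpose_matrix_vector)
  hence "bij_betw (\<lambda>v. transpose A *v v) hyper_vertices hyper_vertices"
    using im inv by (intro bij_betw_byWitness[where f' = "\<lambda>v. A *v v"]) (auto simp del: transpose_matrix_vector)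
  thus ?thesis using A(1) by (simp add: rot_hyper_group_def SO_transpose del: transpose_matrix_vector)
qed

lemma carrier_hyper_G:
  "carrier hyper_G = path_class SO ` {R. rot_path R \<and> R 1 \<in> rot_hyper_group}"
  by (simp add: hyper_G_def rot_path_def conj_assoc)

lemma one_hyper_G: "\<one>\<^bsub>hyper_G\<^esub> = path_class SO (\<lambda>t. mat 1)"
  by (simp add: hyper_G_def)

lemma rot_path_const: "rot_path (\<lambda>t. mat 1)"
  by (auto simp: rot_path_def path_def path_image_def mat_1_in_SO)

lemma rot_path_transpose: "rot_path R \<Longrightarrow> rot_path (\<lambda>t. transpose (R t))"
  by (auto simp: rot_path_def path_def path_image_def intro!: continuous_on_transpose SO_transpose)

lemma group_hyper_G: "group (hyper_G :: (real \<Rightarrow> real^'n^'n) set monoid)"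
proof (rule groupI)
  show "\<one>\<^bsub>hyper_G\<^esub> \<in> carrier hyper_G"
    using rot_path_const mat_1_in_rot_hyper_group by (auto simp: carrier_hyper_G one_hyper_G)
next
  fix x :: "(real \<Rightarrow> real^'n^'n) set" assume "x \<in> carrier hyper_G"
  then obtain R where R: "rot_path R" "R 1 \<in> rot_hyper_group" "x = path_class SO R"
    by (auto simp: carrier_hyper_G)
  show "\<one>\<^bsub>hyper_G\<^esub> \<otimes>\<^bsub>hyper_G\<^esub> x = x"
    by (simp add: R one_hyper_G hyper_G_mult rot_path_const)
  have inv: "rot_path (\<lambda>t. transpose (R t))" by (rule rot_path_transpose[OF R(1)])
  have "path_class SO (\<lambda>t. transpose (R t)) \<otimes>\<^bsub>hyper_G\<^esub> x = path_class SO (\<lambda>t. transpose (R t) ** R t)"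
    by (simp add: R hyper_G_mult inv)
  also have "\<dots> = path_class SO (\<lambda>t. mat 1)"
  proof -
    have "homotopic_paths SO (\<lambda>t. mat 1) (\<lambda>t. transpose (R t) ** R t)"
      using R(1) rot_path_const unfolding rot_path_def
      by (intro homotopic_paths_cong SO_inverse) (auto simp: path_image_def)
    thus ?thesis using rot_path_class_eq_iff[OF rot_path_const] by metis
  qed
  finally show "\<exists>y\<in>carrier hyper_G. y \<otimes>\<^bsub>hyper_G\<^esub> x = \<one>\<^bsub>hyper_G\<^esub>"
    using inv rot_hyper_group_transpose[OF R(2)]
    by (intro bexI[of _ "path_class SO (\<lambda>t. transpose (R t))"]) (auto simp: carrier_hyper_G one_hyper_G)
  fix y :: "(real \<Rightarrow> real^'n^'n) set" assume "y \<in> carrier hyper_G"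
  then obtain S where S: "rot_path S" "S 1 \<in> rot_hyper_group" "y = path_class SO S"
    by (auto simp: carrier_hyper_G)
  show "x \<otimes>\<^bsub>hyper_G\<^esub> y \<in> carrier hyper_G"
    using R S by (auto simp: hyper_G_mult carrier_hyper_G rot_path_pointwise rot_hyper_group_mult)
  fix z :: "(real \<Rightarrow> real^'n^'n) set" assume "z \<in> carrier hyper_G"
  then obtain U where U: "rot_path U" "z = path_class SO U"
    by (auto simp: carrier_hyper_G)
  show "x \<otimes>\<^bsub>hyper_G\<^esub> y \<otimes>\<^bsub>hyper_G\<^esub> z = x \<otimes>\<^bsub>hyper_G\<^esub> (y \<otimes>\<^bsub>hyper_G\<^esub> z)"
    by (simp add: R S U hyper_G_mult rot_path_pointwise matrix_mul_assoc)
qed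

lemma theta_path_class:
  "rot_path R \<Longrightarrow> theta (path_class SO R) = restrict (\<lambda>v. R 1 *v v) hyper_vertices"
  by (simp add: theta_def class_end_path_class)

lemma theta_in_Bij:
  assumes "rot_path R" "R 1 \<in> rot_hyper_group"
  shows "theta (path_class SO R) \<in> Bij hyper_vertices"
  using assms unfolding theta_path_class[OF assms(1)] Bij_def rot_hyper_group_def
  by (auto intro: bij_betw_cong[THEN iffD1, rotated])

lemma group_hom_theta:
  "group_hom (hyper_G :: (real \<Rightarrow> real^'n^'n) set monoid) (BijGroup hyper_vertices) theta"
proof -
  have "theta \<in> hom (hyper_G :: (real \<Rightarrow> real^'n^'n) set monoid) (BijGroup hyper_vertices)"
  proof (rule homI)
    fix x :: "(real \<Rightarrow> real^'n^'n) set" assume "x \<in> carrier hyper_G"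
    then obtain R where R: "rot_path R" "R 1 \<in> rot_hyper_group" "x = path_class SO R"
      by (auto simp: carrier_hyper_G)
    show "theta x \<in> carrier (BijGroup hyper_vertices)"
      using theta_in_Bij R by (simp add: BijGroup_def)
    fix y :: "(real \<Rightarrow> real^'n^'n) set" assume "y \<in> carrier hyper_G"
    then obtain S where S: "rot_path S" "S 1 \<in> rot_hyper_group" "y = path_class SO S"
      by (auto simp: carrier_hyper_G)
    have "S 1 *v v \<in> hyper_vertices" if "v \<in> hyper_vertices" for v
      using S(2) that by (auto simp: rot_hyper_group_def bij_betw_def)
    hence "restrict (\<lambda>v. (R 1 ** S 1) *v v) hyper_vertices =
      compose hyper_vertices (restrict (\<lambda>v. R 1 *v v) hyper_vertices) (restrict (\<lambda>v. S 1 *v v) hyper_vertices)"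
      by (auto simp: fun_eq_iff compose_def restrict_def matrix_vector_mul_assoc)
    thus "theta (x \<otimes>\<^bsub>hyper_G\<^esub> y) = theta x \<otimes>\<^bsub>BijGroup hyper_vertices\<^esub> theta y"
      using theta_in_Bij[OF R(1,2)] theta_in_Bij[OF S(1,2)] R S
      by (simp add: BijGroup_def hyper_G_mult theta_path_class rot_path_pointwise)
  qed
  thus ?thesis
    by (simp add: group_hom_def group_hom_axioms_def group_hyper_G group_BijGroup)
qed

lemma kernel_theta:
  "kernel hyper_G (BijGroup hyper_vertices) theta =
    path_class SO ` {R :: real \<Rightarrow> real^'n^'n. rot_path R \<and> R 1 = mat 1}"
proof -
  have "theta (path_class SO R) = (\<lambda>v\<in>hyper_vertices. v) \<longleftrightarrow> R 1 = mat 1" if "rot_path R" for R :: "real \<Rightarrow> real^'n^'n"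
  proof
    assume "theta (path_class SO R) = (\<lambda>v\<in>hyper_vertices. v)"
    hence "R 1 *v v = v" if "v \<in> hyper_vertices" for v
      using that \<open>rot_path R\<close> by (metis theta_path_class restrict_apply')
    moreover have "axis i 1 \<in> hyper_vertices" for i :: 'n by (auto simp: hyper_vertices_def)
    ultimately show "R 1 = mat 1" by (intro matrix_eq_on_axes) simp
  qed (simp add: theta_path_class that)
  thus ?thesis
    using mat_1_in_rot_hyper_group
    by (fastforce simp: kernel_def carrier_hyper_G BijGroup_def)
qed

lemma carrier_fundamental_group_SO:
  "carrier (fundamental_group SO (mat 1)) = path_class SO ` {R. rot_path R \<and> R 1 = mat 1}"
  by (simp add: fundamental_group_def rot_path_def pathstart_def pathfinish_def conj_assoc)

text \<open>Both groups have the same elements and multiply them pointwise.\<close>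
lemma fundamental_group_iso_kernel:
  fixes G defines "G \<equiv> hyper_G :: (real \<Rightarrow> real^'n^'n) set monoid"
  shows "fundamental_group SO (mat 1 :: real^'n^'n) \<cong>
    G\<lparr>carrier := kernel G (BijGroup hyper_vertices) theta\<rparr>"
proof -
  have "id \<in> iso (fundamental_group SO (mat 1 :: real^'n^'n))
      (G\<lparr>carrier := kernel G (BijGroup hyper_vertices) theta\<rparr>)"
    unfolding G_def
    by (auto simp: iso_def hom_def kernel_theta carrier_fundamental_group_SO hyper_G_mult fundamental_group_mult)
  thus ?thesis by (auto simp: is_iso_def)
qed

lemma rot_path_plane_rotation:
  assumes "a \<noteq> b"
  shows "rot_path (\<lambda>t. plane_rotation a b (x * t))"
  unfolding rot_path_def path_def path_image_def
  using assms by (auto simp: plane_rotation_0 plane_rotation_in_SO intro!: continuous_intros)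

lemma R_plane_pow:
  assumes "a \<noteq> b"
  shows "R_plane a b [^]\<^bsub>hyper_G\<^esub> (n::nat) = path_class SO (\<lambda>t. plane_rotation a b (real n * (pi / 2) * t))"
proof -
  interpret group hyper_G by (rule group_hyper_G)
  show ?thesis
  proof (induction n)
    case 0
    thus ?case by (simp add: one_hyper_G plane_rotation_0)
  next
    case (Suc n)
    have R: "R_plane a b = path_class SO (\<lambda>t. plane_rotation a b ((pi / 2) * t))"
      by (simp add: R_plane_def mult.commute)
    have "R_plane a b [^]\<^bsub>hyper_G\<^esub> Suc n = path_class SO (\<lambda>t. plane_rotation a b (real n * (pi / 2) * t)) \<otimes>\<^bsub>hyper_G\<^esub>
        path_class SO (\<lambda>t. plane_rotation a b ((pi / 2) * t))"
      by (simp only: nat_pow_Suc Suc) (simp only: R)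
    also have "\<dots> = path_class SO (\<lambda>t. plane_rotation a b (real n * (pi / 2) * t) ** plane_rotation a b ((pi / 2) * t))"
      by (intro hyper_G_mult rot_path_plane_rotation assms)
    also have "\<dots> = path_class SO (\<lambda>t. plane_rotation a b (real (Suc n) * (pi / 2) * t))"
      by (simp add: plane_rotation_mult[OF assms] algebra_simps add_divide_distrib)
    finally show ?case .
  qed
qed

theorem mainTheorem1:
  fixes idx :: "nat \<Rightarrow> 'n::finite"
  assumes "CARD('n) \<ge> 3"
    and "bij_betw idx {1..CARD('n)} (UNIV :: 'n set)"
  defines "G \<equiv> (hyper_G :: (real \<Rightarrow> real^'n^'n) set monoid)"
    and "S2n \<equiv> BijGroup (hyper_vertices :: (real^'n) set)"
  defines "K \<equiv> kernel G S2n theta"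
  shows "group_hom G S2n theta
    \<and> fundamental_group SO (mat 1 :: real^'n^'n) \<cong> G\<lparr>carrier := K\<rparr>
    \<and> K = {\<one>\<^bsub>G\<^esub>, R_gen idx 1 [^]\<^bsub>G\<^esub> (4::nat)}
    \<and> G\<lparr>carrier := K\<rparr> \<cong> integer_mod_group 2"
proof -
  have inj: "inj_on idx {1..CARD('n)}" using assms(2) by (simp add: bij_betw_def)
  define a b c where "a = idx 1" and "b = idx 2" and "c = idx 3"
  have abc: "a \<noteq> b" "a \<noteq> c" "b \<noteq> c"
    using assms(1) by (auto simp: a_def b_def c_def inj_on_eq_iff[OF inj])
  let ?turn = "\<lambda>t. plane_rotation a b (2 * pi * t)"
  have turn: "rot_path ?turn" "?turn 1 = mat 1"
    using rot_path_plane_rotation[OF abc(1)] full_turns[of a b 1] by simp_all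
  define x where "x = path_class SO ?turn"
  have R4: "R_gen idx 1 [^]\<^bsub>G\<^esub> (4::nat) = x"
    using R_plane_pow[OF abc(1), of 4] by (simp add: R_gen_def G_def x_def a_def b_def numeral_2_eq_2)
  have one: "\<one>\<^bsub>G\<^esub> = path_class SO (\<lambda>t. mat 1)" by (simp add: G_def one_hyper_G)
  have K: "K = path_class SO ` {R. rot_path R \<and> R 1 = mat 1}"
    unfolding K_def G_def S2n_def by (rule kernel_theta)
  have K2: "K = {\<one>\<^bsub>G\<^esub>, x}"
  proof (intro equalityI subsetI)
    fix y assume "y \<in> K"
    then obtain R where R: "rot_path R" "R 1 = mat 1" "y = path_class SO R" by (auto simp: K)
    thus "y \<in> {\<one>\<^bsub>G\<^esub>, x}"
      using loop_dichotomy[OF abc R(1,2)] by (auto simp: one x_def rot_path_class_eq_iff)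
  qed (use turn rot_path_const in \<open>auto simp: K one x_def\<close>)
  have ne: "x \<noteq> \<one>\<^bsub>G\<^esub>"
    using full_turn_not_null_homotopic[OF abc(1)] by (simp add: x_def one rot_path_class_eq_iff turn)
  have xx: "x \<otimes>\<^bsub>G\<^esub> x = \<one>\<^bsub>G\<^esub>"
  proof -
    have "x \<otimes>\<^bsub>G\<^esub> x = path_class SO (\<lambda>t. ?turn t ** ?turn t)"
      unfolding x_def G_def by (rule hyper_G_mult[OF turn(1) turn(1)])
    also have "\<dots> = path_class SO (\<lambda>t. plane_rotation a b (2 * pi * of_int (2 * 1) * t))"
      by (simp add: plane_rotation_mult[OF abc(1)] algebra_simps)
    also have "\<dots> = \<one>\<^bsub>G\<^esub>"
      using even_turns_null_homotopic[OF abc, of 1] rot_path_plane_rotation[OF abc(1)]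
      by (simp add: one rot_path_class_eq_iff)
    finally show ?thesis .
  qed
  interpret G: group G unfolding G_def by (rule group_hyper_G)
  have xG: "x \<in> carrier G" using K2 unfolding K_def kernel_def by blast
  have "(\<lambda>y. if y = x then 1 else 0) \<in> iso (G\<lparr>carrier := K\<rparr>) (integer_mod_group 2)"
    unfolding iso_def hom_def
    using ne by (auto simp: K2 xx xG integer_mod_group_def bij_betw_def inj_on_def)
  hence "G\<lparr>carrier := K\<rparr> \<cong> integer_mod_group 2" by (auto simp: is_iso_def)
  moreover have "group_hom G S2n theta" unfolding G_def S2n_def by (rule group_hom_theta)
  moreover have "fundamental_group SO (mat 1 :: real^'n^'n) \<cong> G\<lparr>carrier := K\<rparr>"
    unfolding K_def G_def S2n_def by (rule fundamental_group_iso_kernel)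
  ultimately show ?thesis using K2 R4 by simp
qed

end
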